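(* Let $\tau$ be a cyclic permutation and assume that $F\in\mathcal{S}(\Omega)$ exhibits the strips pattern $\tau$. Then $$h(F)\ge h(F_\tau)=h(f_\tau),$$ where $f_\tau$ is a $\tau$-linear interval map, $F_\tau$ is a quasiperiodic $\tau$-linear map, and $h$ denotes topological entropy.
   Context: Let $\mathbb{S}^1=\mathbb{R}/\mathbb{Z}$, $\mathbb{I}=[0,1]$, $\Omega=\mathbb{S}^1\times\mathbb{I}$, and let $\pi:\Omega\to\mathbb{S}^1$ be the projection. $\mathcal{S}(\Omega)$ is the class of all maps $F:\Omega\to\Omega$ of the form $F(\theta,x)=(R_\omega(\theta),f(\theta,x))$, where $R_\omega(\theta)=\theta+\omega \pmod 1$ with $\omega\in\mathbb{R}\setminus\mathbb{Q}$ and $f:\Omega\to\mathbb{I}$ is continuous. A set is residual if it contains the intersection of a countable family of open dense sets. A $\tau$-linear map $f_\tau$, for a cyclic permutation $\tau$ of $\{1,\dots,n\}$: choose points $p_1<\dots<p_n$ in $\mathbb{I}$; $f_\tau:\mathbb{I}\to\mathbb{I}$ is the continuous map with $f_\tau(p_i)=p_{\tau(i)}$ for all $i$, affine on each $[p_i,p_{i+1}]$, and constant on each connected component of $\mathbb{I}\setminus[p_1,p_n]$. (The entropy does not depend on the choice of the points $p_i$.) A quasiperiodic $\tau$-linear map is $F_\tau\in\mathcal{S}(\Omega)$, $F_\tau(\theta,x)=(R_\omega(\theta),f_\tau(x))$, with $R_\omega$ the rotation by an irrational angle $\omega$. A strip is a closed set $B\subset\Omega$ with $\pi(B)=\mathbb{S}^1$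 such that $\pi^{-1}(\theta)\cap B$ is a closed interval (possibly a point) for every $\theta$ in a residual subset of $\mathbb{S}^1$. For a strip $A$ put $M_A(\theta)=\max\{x:(\theta,x)\in A\}$ and $m_A(\theta)=\min\{x:(\theta,x)\in A\}$. For strips $A,B$ write $A<B$ if there is a residual set $G\subset\mathbb{S}^1$ with $M_A(\theta)<m_B(\theta)$ for all $\theta\in G$; $A,B$ are ordered if $A<B$ or $B<A$. For $F\in\mathcal{S}(\Omega)$, a strip $A$ is $p$-periodic if $F^p(A)=A$ and $A,F(A),\dots,F^{p-1}(A)$ are pairwise disjoint and pairwise ordered strips; then $\{A,F(A),\dots,F^{p-1}(A)\}$ is a periodic orbit of strips of period $p$. Writing it as $\{B_1,\dots,B_p\}$ with $B_1<\dots<B_p$, its strips pattern is the permutation $\tau$ with $F(B_i)=B_{\tau(i)}$ for all $i$. $F$ exhibits the strips pattern $\tau$ if it has a periodic orbit of strips with strips pattern $\tau$. *)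

theory Defs
  imports "HOL-Analysis.Analysis" "HOL-Combinatorics.Orbits"
begin

section \<open>Topological entropy\<close>

text \<open>
  Bowen's definition for a self-map \<open>T\<close> of a compact subset \<open>X\<close> of a metric space.
  Since the growth rate is antitone in \<open>\<epsilon>\<close>, the limit for \<open>\<epsilon> \<rightarrow> 0\<close> is a supremum.
\<close>

definition separated :: "'a::metric_space set \<Rightarrow> ('a \<Rightarrow> 'a) \<Rightarrow> nat \<Rightarrow> real \<Rightarrow> 'a set \<Rightarrow> bool" where
  "separated X T n \<epsilon> E \<longleftrightarrow>
     E \<subseteq> X \<and> (\<forall>x\<in>E. \<forall>y\<in>E. x \<noteq> y \<longrightarrow> (\<exists>k<n. dist ((T ^^ k) x) ((T ^^ k) y) > \<epsilon>))"

definition log_max_separated :: "'a::metric_space set \<Rightarrow> ('a \<Rightarrow> 'a) \<Rightarrow> nat \<Rightarrow> real \<Rightarrow> ereal" where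
  "log_max_separated X T n \<epsilon> =
     (SUP E \<in> {E. finite E \<and> separated X T n \<epsilon> E}. ereal (ln (real (card E))))"

definition top_entropy :: "'a::metric_space set \<Rightarrow> ('a \<Rightarrow> 'a) \<Rightarrow> ereal" where
  "top_entropy X T =
     (SUP \<epsilon>\<in>{0<..}. limsup (\<lambda>n. log_max_separated X T n \<epsilon> / ereal (real n)))"

section \<open>Quasiperiodically forced maps on the cylinder\<close>

text \<open>
  The circle \<open>\<real>/\<int>\<close> is the unit circle of the complex plane, the class of \<open>\<theta>\<close> being
  \<open>cis (2 * pi * \<theta>)\<close>; translation by \<open>\<omega>\<close> modulo 1 becomes multiplication by
  \<open>cis (2 * pi * \<omega>)\<close>.
\<close>

definition circle :: "complex set" where
  "circle = sphere 0 1"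

definition rot :: "real \<Rightarrow> complex \<Rightarrow> complex" where
  "rot \<omega> \<theta> = cis (2 * pi * \<omega>) * \<theta>"

definition unit_interval :: "real set" where
  "unit_interval = {0..1}"

definition cylinder :: "(complex \<times> real) set" where
  "cylinder = circle \<times> unit_interval"

definition forced_maps :: "(complex \<times> real \<Rightarrow> complex \<times> real) set" where
  "forced_maps = {F. \<exists>\<omega> f. \<omega> \<notin> \<rat> \<and> continuous_on cylinder f \<and> f ` cylinder \<subseteq> unit_interval \<and>
     (\<forall>\<theta>\<in>circle. \<forall>x\<in>unit_interval. F (\<theta>, x) = (rot \<omega> \<theta>, f (\<theta>, x)))}"

section \<open>Strips and their patterns\<close>

definition residual_in :: "'a topology \<Rightarrow> 'a set \<Rightarrow> bool" where
  "residual_in X G \<longleftrightarrow> G \<subseteq> topspace X \<and>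
     (\<exists>\<U>. countable \<U> \<and> (\<forall>U\<in>\<U>. openin X U \<and> X closure_of U = topspace X) \<and>
          topspace X \<inter> \<Inter>\<U> \<subseteq> G)"

definition fibre :: "(complex \<times> real) set \<Rightarrow> complex \<Rightarrow> real set" where
  "fibre B \<theta> = {x. (\<theta>, x) \<in> B}"

definition strip :: "(complex \<times> real) set \<Rightarrow> bool" where
  "strip B \<longleftrightarrow> closed B \<and> B \<subseteq> cylinder \<and> fst ` B = circle \<and>
     (\<exists>G. residual_in (top_of_set circle) G \<and>
          (\<forall>\<theta>\<in>G. \<exists>a b. a \<le> b \<and> fibre B \<theta> = {a..b}))"

text \<open>
  The fibres of a strip over the circle are compact and nonempty, so the supremum and infimum
  below are the maximum and minimum.
\<close>

definition strip_max :: "(complex \<times> real) set \<Rightarrow> complex \<Rightarrow> real" where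
  "strip_max A \<theta> = Sup (fibre A \<theta>)"

definition strip_min :: "(complex \<times> real) set \<Rightarrow> complex \<Rightarrow> real" where
  "strip_min A \<theta> = Inf (fibre A \<theta>)"

definition strip_less :: "(complex \<times> real) set \<Rightarrow> (complex \<times> real) set \<Rightarrow> bool" where
  "strip_less A B \<longleftrightarrow>
     (\<exists>G. residual_in (top_of_set circle) G \<and> (\<forall>\<theta>\<in>G. strip_max A \<theta> < strip_min B \<theta>))"

definition strips_ordered :: "(complex \<times> real) set \<Rightarrow> (complex \<times> real) set \<Rightarrow> bool" where
  "strips_ordered A B \<longleftrightarrow> strip_less A B \<or> strip_less B A"

definition periodic_strip ::
  "(complex \<times> real \<Rightarrow> complex \<times> real) \<Rightarrow> nat \<Rightarrow> (complex \<times> real) set \<Rightarrow> bool" where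
  "periodic_strip F p A \<longleftrightarrow> 0 < p \<and> (F ^^ p) ` A = A \<and>
     (\<forall>i<p. strip ((F ^^ i) ` A)) \<and>
     (\<forall>i<p. \<forall>j<p. i \<noteq> j \<longrightarrow>
        (F ^^ i) ` A \<inter> (F ^^ j) ` A = {} \<and> strips_ordered ((F ^^ i) ` A) ((F ^^ j) ` A))"

definition periodic_strip_orbit ::
  "(complex \<times> real \<Rightarrow> complex \<times> real) \<Rightarrow> nat \<Rightarrow> (complex \<times> real) set set \<Rightarrow> bool" where
  "periodic_strip_orbit F p \<B> \<longleftrightarrow> (\<exists>A. periodic_strip F p A \<and> \<B> = {(F ^^ i) ` A | i. i < p})"

definition has_strips_pattern ::
  "(complex \<times> real \<Rightarrow> complex \<times> real) \<Rightarrow> nat \<Rightarrow> (complex \<times> real) set set \<Rightarrow> (nat \<Rightarrow> nat) \<Rightarrow> bool" where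
  "has_strips_pattern F p \<B> \<tau> \<longleftrightarrow> \<tau> permutes {1..p} \<and>
     (\<exists>B. bij_betw B {1..p} \<B> \<and>
          (\<forall>i\<in>{1..p}. \<forall>j\<in>{1..p}. i < j \<longrightarrow> strip_less (B i) (B j)) \<and>
          (\<forall>i\<in>{1..p}. F ` B i = B (\<tau> i)))"

definition exhibits_strips_pattern ::
  "(complex \<times> real \<Rightarrow> complex \<times> real) \<Rightarrow> nat \<Rightarrow> (nat \<Rightarrow> nat) \<Rightarrow> bool" where
  "exhibits_strips_pattern F p \<tau> \<longleftrightarrow>
     (\<exists>\<B>. periodic_strip_orbit F p \<B> \<and> has_strips_pattern F p \<B> \<tau>)"

section \<open>Piecewise linear models\<close>

definition cyclic_permutation :: "nat \<Rightarrow> (nat \<Rightarrow> nat) \<Rightarrow> bool" where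
  "cyclic_permutation n \<tau> \<longleftrightarrow> \<tau> permutes {1..n} \<and> cyclic_on \<tau> {1..n}"

definition tau_linear :: "nat \<Rightarrow> (nat \<Rightarrow> nat) \<Rightarrow> (real \<Rightarrow> real) \<Rightarrow> bool" where
  "tau_linear n \<tau> f \<longleftrightarrow> continuous_on unit_interval f \<and> f ` unit_interval \<subseteq> unit_interval \<and>
     (\<exists>q. strict_mono_on {1..n} q \<and> q ` {1..n} \<subseteq> unit_interval \<and>
          (\<forall>i\<in>{1..n}. f (q i) = q (\<tau> i)) \<and>
          (\<forall>i\<in>{1..<n}. \<exists>a b. \<forall>x\<in>{q i..q (Suc i)}. f x = a * x + b) \<and>
          (\<forall>C\<in>components (unit_interval - {q 1..q n}). f constant_on C))"

definition quasiperiodic_linear :: "real \<Rightarrow> (real \<Rightarrow> real) \<Rightarrow> complex \<times> real \<Rightarrow> complex \<times> real" where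
  "quasiperiodic_linear \<omega> f = (\<lambda>(\<theta>, x). (rot \<omega> \<theta>, f x))"

end

theory Submission
  imports Defs "HOL-Real_Asymp.Real_Asymp"
begin

text \<open>
  Rotations are isometries, so they do not contribute entropy and \<open>h(F\<^sub>\<tau>) = h(f\<^sub>\<tau>)\<close>. The entropy of
  \<open>f\<^sub>\<tau>\<close> is at most the growth rate of the number of paths in its Markov graph. Conversely, by Baire's
  theorem there is a fibre whose whole forward orbit meets the strips in the right order; over this orbit
  the gaps between consecutive strips cover each other as the Markov graph prescribes, so every path is
  followed by a point of that fibre. Adjacent gaps may touch, but the strips are disjoint and compact, so
  gaps have length at least some \<open>\<delta> > 0\<close>. Two paths followed by nearby points can therefore only differ
  while both points are close to a common strip, and then they stay close to it for \<open>L\<close> steps, during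
  which the Markov graph leaves no choice. Hence at most \<open>(L + 1) ^ (k div L + 1)\<close> paths of length \<open>k\<close> are
  indistinguishable at a small scale depending on \<open>L\<close>; the loss \<open>ln (L + 1) / L\<close> in the growth rate
  tends to 0.
\<close>

section \<open>Entropy and isometric base maps\<close>

lemma card_le_log_max_separated:
  assumes "finite E" "separated X T n \<epsilon> E"
  shows "ereal (ln (real (card E))) \<le> log_max_separated X T n \<epsilon>"
  unfolding log_max_separated_def using assms by (intro SUP_upper) auto

text \<open>The empty set is separated and contributes \<open>ln 0 = 0\<close>.\<close>

lemma log_max_separated_nonneg: "0 \<le> log_max_separated X T n \<epsilon>"
  using card_le_log_max_separated[of "{}" X T n \<epsilon>] by (simp add: separated_def zero_ereal_def)

lemma log_max_separated_leI:
  assumes "\<And>E. finite E \<Longrightarrow> E \<noteq> {} \<Longrightarrow> separated X T n \<epsilon> E \<Longrightarrow> ereal (ln (real (card E))) \<le> c"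
    and "0 \<le> c"
  shows "log_max_separated X T n \<epsilon> \<le> c"
  unfolding log_max_separated_def
proof (rule SUP_least)
  fix E assume "E \<in> {E. finite E \<and> separated X T n \<epsilon> E}"
  then show "ereal (ln (real (card E))) \<le> c"
    using assms by (cases "E = {}") (auto simp: zero_ereal_def)
qed

text \<open>An additive error changes the growth rate by at most its own linear rate
  \<open>c\<close>. In the final comparison constants and logarithms thus cost nothing, while
  working with blocks of length \<open>L\<close> costs \<open>ln (L + 1) / L\<close>.\<close>

lemma limsup_growth_le:
  fixes u v :: "nat \<Rightarrow> ereal" and r :: "nat \<Rightarrow> real"
  assumes uv: "\<And>k. k > 0 \<Longrightarrow> u k \<le> v k + ereal (r k)"
    and r: "(\<lambda>k. r k / real k) \<longlonglongrightarrow> c"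
  shows "limsup (\<lambda>k. u k / ereal (real k)) \<le> limsup (\<lambda>k. v k / ereal (real k)) + ereal c"
proof -
  have "limsup (\<lambda>k. u k / ereal (real k)) \<le> limsup (\<lambda>k. ereal (r k / real k) + v k / ereal (real k))"
  proof (rule Limsup_mono)
    show "\<forall>\<^sub>F k in sequentially. u k / ereal (real k) \<le> ereal (r k / real k) + v k / ereal (real k)"
      using eventually_gt_at_top[of 0]
    proof eventually_elim
      case (elim k)
      have "u k / ereal (real k) \<le> (v k + ereal (r k)) / ereal (real k)"
        using uv[OF elim] elim by (intro ereal_divide_right_mono) auto
      also have "\<dots> = ereal (r k / real k) + v k / ereal (real k)"
        using elim by (cases "v k") (auto simp: add_divide_distrib)
      finally show ?case .
    qed
  qed
  also have "\<dots> = ereal c + limsup (\<lambda>k. v k / ereal (real k))"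
    using r by (intro ereal_limsup_lim_add) auto
  finally show ?thesis by (simp add: add.commute)
qed

lemma limsup_le_top_entropy:
  "\<epsilon> > 0 \<Longrightarrow> limsup (\<lambda>n. log_max_separated X T n \<epsilon> / ereal (real n)) \<le> top_entropy X T"
  unfolding top_entropy_def by (intro SUP_upper) auto

section \<open>Rotations and skew products over them\<close>

lemma rot_in_circle: "\<theta> \<in> circle \<Longrightarrow> rot \<omega> \<theta> \<in> circle"
  by (simp add: circle_def rot_def norm_mult)

lemma dist_rot: "dist (rot \<omega> x) (rot \<omega> y) = dist x y"
proof -
  have "rot \<omega> x - rot \<omega> y = cis (2 * pi * \<omega>) * (x - y)"
    by (simp add: rot_def algebra_simps)
  then show ?thesis by (simp add: dist_norm norm_mult)
qed

lemma dist_rot_funpow: "dist ((rot \<omega> ^^ k) x) ((rot \<omega> ^^ k) y) = dist x y"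
  by (induction k) (simp_all add: dist_rot)

lemma quasiperiodic_linear_funpow:
  "(quasiperiodic_linear \<omega> f ^^ k) u = ((rot \<omega> ^^ k) (fst u), (f ^^ k) (snd u))"
  by (induction k) (simp_all add: quasiperiodic_linear_def case_prod_beta)

lemma compact_circle: "compact circle"
  by (simp add: circle_def)

lemma one_in_circle: "1 \<in> circle"
  by (simp add: circle_def)

text \<open>The rotation is an isometry, so points whose base points lie in a common small arc have to be
  separated by the fibre map.\<close>
lemma separated_product_card_le:
  assumes "\<epsilon> > 0"
  obtains K :: nat where "\<And>n E. finite E \<Longrightarrow> E \<noteq> {} \<Longrightarrow> separated cylinder (quasiperiodic_linear \<omega> f) n \<epsilon> E \<Longrightarrow>
     \<exists>D. finite D \<and> D \<noteq> {} \<and> separated unit_interval f n (\<epsilon>/2) D \<and> card E \<le> K * card D"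
proof -
  \<comment> \<open>With radius \<open>\<epsilon>/4\<close>, base points in one ball are less than
    \<open>\<epsilon>/2\<close> apart, which leaves more than \<open>\<epsilon>/2\<close> for the
    fibre coordinate.\<close>
  have "circle \<subseteq> (\<Union>c\<in>circle. ball c (\<epsilon>/4))" using assms by auto
  then obtain C where C: "finite C" "C \<subseteq> circle" "circle \<subseteq> (\<Union>c\<in>C. ball c (\<epsilon>/4))"
    by (rule compactE_image[OF compact_circle, rotated]) auto
  show ?thesis
  proof (rule that[of "card C"])
    fix n E assume E: "finite E" "E \<noteq> {}" "separated cylinder (quasiperiodic_linear \<omega> f) n \<epsilon> E"
    have Ecyl: "E \<subseteq> cylinder" using E(3) by (simp add: separated_def)
    define P where "P = (\<lambda>c. {u\<in>E. fst u \<in> ball c (\<epsilon>/4)})"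
    have EP: "E = (\<Union>c\<in>C. P c)"
      using Ecyl C(3) by (force simp: P_def cylinder_def)
    have "C \<noteq> {}" using E(2) EP by auto
    have far: "\<exists>k<n. dist ((f ^^ k) (snd u)) ((f ^^ k) (snd v)) > \<epsilon>/2"
      if uv: "u \<in> P c" "v \<in> P c" "u \<noteq> v" for c u v
    proof -
      obtain k where k: "k < n" "dist ((quasiperiodic_linear \<omega> f ^^ k) u) ((quasiperiodic_linear \<omega> f ^^ k) v) > \<epsilon>"
        using E(3) uv unfolding separated_def P_def by blast
      have "dist (fst u) (fst v) < \<epsilon>/2"
        using uv dist_triangle3[of "fst u" "fst v" c] by (auto simp: P_def)
      \<comment> \<open>The product metric is at most the sum of the coordinate distances, and the
        rotation keeps the first of them constant in \<open>k\<close>.\<close>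
      moreover have "\<epsilon> < dist (fst u) (fst v) + dist ((f ^^ k) (snd u)) ((f ^^ k) (snd v))"
        using k(2) sqrt_sum_squares_le_sum[of "dist (fst u) (fst v)" "dist ((f ^^ k) (snd u)) ((f ^^ k) (snd v))"]
        by (simp add: quasiperiodic_linear_funpow dist_Pair_Pair dist_rot_funpow)
      ultimately show ?thesis using k(1) by (intro exI[of _ k]) auto
    qed
    have fin: "finite (P c)" for c using E(1) by (simp add: P_def)
    have inj: "inj_on snd (P c)" for c
    proof (rule inj_onI, rule ccontr)
      fix u v assume "u \<in> P c" "v \<in> P c" "snd u = snd v" "u \<noteq> v"
      then show False using far[of u c v] assms by auto
    qed
    \<comment> \<open>Pigeonhole: a largest piece \<open>P c\<close> has at least the average share
      of \<open>E\<close>.\<close>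
    have "finite (card ` P ` C)" "card ` P ` C \<noteq> {}" using C(1) \<open>C \<noteq> {}\<close> by auto
    then have "Max (card ` P ` C) \<in> card ` P ` C" by (rule Max_in)
    then obtain c where c: "c \<in> C" "Max (card ` P ` C) = card (P c)" by auto
    have Pmax: "card (P c') \<le> card (P c)" if "c' \<in> C" for c'
      using that C(1) c(2) by (metis Max_ge finite_imageI imageI)
    have "card E \<le> (\<Sum>c'\<in>C. card (P c'))"
      unfolding EP by (rule card_UN_le[OF C(1)])
    also have "\<dots> \<le> card C * card (P c)"
      using sum_bounded_above[of C "\<lambda>c. card (P c)" "card (P c)"] Pmax by simp
    finally have le: "card E \<le> card C * card (P c)" .
    then have "P c \<noteq> {}" using E by (auto simp: card_eq_0_iff)
    moreover have "separated unit_interval f n (\<epsilon>/2) (snd ` P c)"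
      unfolding separated_def
    proof (intro conjI ballI impI)
      show "snd ` P c \<subseteq> unit_interval"
        using Ecyl by (auto simp: P_def cylinder_def)
    next
      fix x y assume "x \<in> snd ` P c" "y \<in> snd ` P c" "x \<noteq> y"
      then show "\<exists>k<n. dist ((f ^^ k) x) ((f ^^ k) y) > \<epsilon>/2" using far by auto
    qed
    ultimately show "\<exists>D. finite D \<and> D \<noteq> {} \<and> separated unit_interval f n (\<epsilon>/2) D \<and> card E \<le> card C * card D"
      using le fin card_image[OF inj] by (intro exI[of _ "snd ` P c"]) auto
  qed
qed

text \<open>The factor \<open>K\<close> does not depend on \<open>n\<close>, so it disappears in the
  growth rate, and halving the scale is absorbed by the supremum over \<open>\<epsilon>\<close>. For
  the reverse inequality the interval is embedded as the fibre over 1.\<close>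

lemma top_entropy_quasiperiodic_linear:
  "top_entropy cylinder (quasiperiodic_linear \<omega> f) = top_entropy unit_interval f"
proof (rule antisym)
  show "top_entropy cylinder (quasiperiodic_linear \<omega> f) \<le> top_entropy unit_interval f"
    unfolding top_entropy_def[of cylinder]
  proof (rule SUP_least)
    fix \<epsilon> :: real assume "\<epsilon> \<in> {0<..}"
    then have \<epsilon>: "\<epsilon> > 0" by simp
    obtain K :: nat where K: "\<And>n E. finite E \<Longrightarrow> E \<noteq> {} \<Longrightarrow>
       separated cylinder (quasiperiodic_linear \<omega> f) n \<epsilon> E \<Longrightarrow>
       \<exists>D. finite D \<and> D \<noteq> {} \<and> separated unit_interval f n (\<epsilon>/2) D \<and> card E \<le> K * card D"
      using separated_product_card_le[OF \<epsilon>, of \<omega> f] by blast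
    have "log_max_separated cylinder (quasiperiodic_linear \<omega> f) n \<epsilon>
            \<le> log_max_separated unit_interval f n (\<epsilon>/2) + ereal (ln (real (max K 1)))" for n
    proof (rule log_max_separated_leI)
      fix E assume E: "finite E" "E \<noteq> {}" "separated cylinder (quasiperiodic_linear \<omega> f) n \<epsilon> E"
      then obtain D where D: "finite D" "D \<noteq> {}" "separated unit_interval f n (\<epsilon>/2) D" "card E \<le> K * card D"
        using K by blast
      have pos: "card E > 0" "card D > 0" using E D by (auto simp: card_gt_0_iff)
      have "card E \<le> max K 1 * card D" using D(4) by (meson le_trans max.cobounded1 mult_le_mono1)
      then have "real (card E) \<le> real (max K 1) * real (card D)"
        by (metis of_nat_le_iff of_nat_mult)
      then have "ln (real (card E)) \<le> ln (real (max K 1) * real (card D))"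
        using pos by (subst ln_le_cancel_iff) auto
      also have "\<dots> = ln (real (card D)) + ln (real (max K 1))"
        using pos by (subst ln_mult_pos) auto
      finally have "ereal (ln (real (card E))) \<le> ereal (ln (real (card D))) + ereal (ln (real (max K 1)))"
        by simp
      also have "\<dots> \<le> log_max_separated unit_interval f n (\<epsilon>/2) + ereal (ln (real (max K 1)))"
        using D by (intro add_right_mono card_le_log_max_separated)
      finally show "ereal (ln (real (card E))) \<le>
         log_max_separated unit_interval f n (\<epsilon>/2) + ereal (ln (real (max K 1)))" .
    next
      show "0 \<le> log_max_separated unit_interval f n (\<epsilon>/2) + ereal (ln (real (max K 1)))"
        using log_max_separated_nonneg by (intro add_nonneg_nonneg) auto
    qed
    then have "limsup (\<lambda>n. log_max_separated cylinder (quasiperiodic_linear \<omega> f) n \<epsilon> / ereal (real n))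
        \<le> limsup (\<lambda>n. log_max_separated unit_interval f n (\<epsilon>/2) / ereal (real n)) + ereal 0"
      by (rule limsup_growth_le) (intro lim_const_over_n)
    also have "\<dots> \<le> top_entropy unit_interval f"
      using limsup_le_top_entropy[of "\<epsilon>/2" unit_interval f] \<epsilon> by simp
    finally show "limsup (\<lambda>n. log_max_separated cylinder (quasiperiodic_linear \<omega> f) n \<epsilon> / ereal (real n))
        \<le> top_entropy unit_interval f" .
  qed
next
  have "log_max_separated unit_interval f n \<epsilon> \<le> log_max_separated cylinder (quasiperiodic_linear \<omega> f) n \<epsilon>"
    for n \<epsilon>
  proof (rule log_max_separated_leI[OF _ log_max_separated_nonneg])
    fix D assume D: "finite D" "separated unit_interval f n \<epsilon> D"
    have "separated cylinder (quasiperiodic_linear \<omega> f) n \<epsilon> (Pair 1 ` D)"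
      using D(2) one_in_circle
      by (force simp: separated_def cylinder_def quasiperiodic_linear_funpow dist_Pair_Pair)
    moreover have "card (Pair (1::complex) ` D) = card D"
      by (intro card_image inj_onI) simp
    ultimately show "ereal (ln (real (card D))) \<le> log_max_separated cylinder (quasiperiodic_linear \<omega> f) n \<epsilon>"
      using card_le_log_max_separated[of "Pair 1 ` D"] D(1) by fastforce
  qed
  then have "log_max_separated unit_interval f n \<epsilon> / ereal (real n) \<le>
      log_max_separated cylinder (quasiperiodic_linear \<omega> f) n \<epsilon> / ereal (real n)" if "n > 0" for n \<epsilon>
    using that by (intro ereal_divide_right_mono) auto
  then show "top_entropy unit_interval f \<le> top_entropy cylinder (quasiperiodic_linear \<omega> f)"
    unfolding top_entropy_def
    by (intro SUP_mono' Limsup_mono eventually_mono[OF eventually_gt_at_top[of 0]])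
qed

section \<open>Markov paths and piecewise linear maps\<close>

text \<open>The Markov graph of the piecewise linear map: vertex \<open>s\<close> is the interval
  between the marked points \<open>s\<close> and \<open>Suc s\<close>, with edges to the intervals
  covered by its image.\<close>

definition markov_edge :: "(nat \<Rightarrow> nat) \<Rightarrow> nat \<Rightarrow> nat \<Rightarrow> bool" where
  "markov_edge \<tau> s t \<longleftrightarrow> min (\<tau> s) (\<tau> (Suc s)) \<le> t \<and> t < max (\<tau> s) (\<tau> (Suc s))"

text \<open>The parameter \<open>k\<close> counts vertices, to match the \<open>k\<close> points of
  an orbit segment.\<close>

definition markov_paths :: "nat \<Rightarrow> (nat \<Rightarrow> nat) \<Rightarrow> nat \<Rightarrow> nat list set" where
  "markov_paths n \<tau> k = {w. length w = k \<and> set w \<subseteq> {1..<n} \<and> successively (markov_edge \<tau>) w}"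

lemma finite_markov_paths: "finite (markov_paths n \<tau> k)"
  by (rule finite_subset[OF _ finite_lists_length_eq[of "{1..<n}" k]]) (auto simp: markov_paths_def)

text \<open>Points with the same itinerary \<open>c\<close> are told apart by \<open>\<lfloor>\<phi> x / \<epsilon>\<rfloor>\<close>, where \<open>\<phi>\<close> sums the orbit
  with the orientations of the iterates as signs: \<open>\<phi> y - \<phi> x\<close> is then a sum of distances.\<close>
lemma separated_card_le_itineraries:
  fixes f :: "real \<Rightarrow> real" and J :: "nat \<Rightarrow> real set" and c :: "real \<Rightarrow> nat list"
  assumes fin: "finite E" and sep: "separated {0..1} f k \<epsilon> E" and eps: "\<epsilon> > 0"
    and inv: "f ` {0..1} \<subseteq> {0..1}"
    and aff: "\<And>i x y. x \<in> J i \<Longrightarrow> y \<in> J i \<Longrightarrow> f y - f x = a i * (y - x)"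
    and itin: "\<And>x j. x \<in> E \<Longrightarrow> j < k \<Longrightarrow> (f ^^ j) x \<in> J (c x ! j)"
    and C: "finite C" "c ` E \<subseteq> C"
  shows "real (card E) \<le> real (card C) * (2 * real k / \<epsilon> + 3)"
proof -
  \<comment> \<open>\<open>s w j\<close> is the orientation of the \<open>j\<close>-th iterate along
    the itinerary \<open>w\<close>: the sign of the product of the slopes met before time
    \<open>j\<close>.\<close>
  define s where "s = (\<lambda>w j. sgn (\<Prod>i<j. a (w ! i)))"
  define \<phi> where "\<phi> = (\<lambda>x. \<Sum>j<k. s (c x) j * (f ^^ j) x)"
  have in01: "(f ^^ j) x \<in> {0..1}" if "x \<in> {0..1}" for x j
    using that inv by (induction j) (auto simp: image_subset_iff)
  have E01: "E \<subseteq> {0..1}" using sep by (simp add: separated_def)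
  have diff: "(f ^^ j) y - (f ^^ j) x = (\<Prod>i<j. a (c x ! i)) * (y - x)"
    if "x \<in> E" "y \<in> E" "c x = c y" "j \<le> k" for x y j
    using that(4)
  proof (induction j)
    case (Suc j)
    have "(f ^^ Suc j) y - (f ^^ Suc j) x = a (c x ! j) * ((f ^^ j) y - (f ^^ j) x)"
      using aff[OF itin[of x j] itin[of y j, folded that(3)]] that Suc.prems by simp
    then show ?case using Suc by simp
  qed simp
  have \<phi>_gap: "\<phi> y - \<phi> x > \<epsilon>" if xy: "x \<in> E" "y \<in> E" "c x = c y" "x < y" for x y
  proof -
    have term_eq: "s (c y) j * (f ^^ j) y - s (c x) j * (f ^^ j) x = \<bar>(f ^^ j) y - (f ^^ j) x\<bar>"
      if "j < k" for j
    proof -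
      have "s (c y) j * (f ^^ j) y - s (c x) j * (f ^^ j) x = s (c x) j * ((f ^^ j) y - (f ^^ j) x)"
        using xy(3) by (simp add: algebra_simps)
      also have "\<dots> = \<bar>\<Prod>i<j. a (c x ! i)\<bar> * \<bar>y - x\<bar>"
        using diff[OF xy(1-3), of j] that xy(4) by (simp add: s_def abs_sgn mult.assoc)
      also have "\<dots> = \<bar>(f ^^ j) y - (f ^^ j) x\<bar>"
        using diff[OF xy(1-3), of j] that by (simp add: abs_mult)
      finally show ?thesis .
    qed
    obtain m where m: "m < k" "\<bar>(f ^^ m) y - (f ^^ m) x\<bar> > \<epsilon>"
      using sep xy unfolding separated_def by (metis dist_real_def less_irrefl)
    \<comment> \<open>One time at which the points are separated suffices, since all other summands
      are nonnegative.\<close>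
    have "\<bar>(f ^^ m) y - (f ^^ m) x\<bar> \<le> (\<Sum>j<k. \<bar>(f ^^ j) y - (f ^^ j) x\<bar>)"
      using m(1) by (intro member_le_sum) auto
    also have "\<dots> = \<phi> y - \<phi> x"
      by (simp add: \<phi>_def sum_subtractf[symmetric] term_eq)
    finally show ?thesis using m(2) by simp
  qed
  have \<phi>_bound: "\<bar>\<phi> x\<bar> \<le> real k" if "x \<in> E" for x
  proof -
    have "\<bar>s (c x) j * (f ^^ j) x\<bar> \<le> 1" for j
    proof -
      have "\<bar>s (c x) j\<bar> \<le> 1" by (simp add: s_def sgn_if)
      moreover have "\<bar>(f ^^ j) x\<bar> \<le> 1" using in01[of x j] that E01 by auto
      ultimately show ?thesis by (simp add: abs_mult mult_le_one)
    qed
    then have "\<bar>\<phi> x\<bar> \<le> (\<Sum>j<k. 1)" unfolding \<phi>_def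
      by (intro order_trans[OF sum_abs] sum_mono) auto
    then show ?thesis by simp
  qed
  \<comment> \<open>As \<open>\<phi>\<close> is bounded by \<open>k\<close> in modulus on
    \<open>E\<close>, the integer part takes values in \<open>R\<close>, whose size is at most
    linear in \<open>k\<close>.\<close>
  define R where "R = {\<lfloor>- (real k / \<epsilon>)\<rfloor>..\<lfloor>real k / \<epsilon>\<rfloor>}"
  have "inj_on (\<lambda>x. (c x, \<lfloor>\<phi> x / \<epsilon>\<rfloor>)) E"
  proof (rule linorder_inj_onI)
    fix x y assume xy: "x < y" "x \<in> E" "y \<in> E"
    show "(c x, \<lfloor>\<phi> x / \<epsilon>\<rfloor>) \<noteq> (c y, \<lfloor>\<phi> y / \<epsilon>\<rfloor>)"
    proof
      assume eq: "(c x, \<lfloor>\<phi> x / \<epsilon>\<rfloor>) = (c y, \<lfloor>\<phi> y / \<epsilon>\<rfloor>)"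
      then have "\<phi> y / \<epsilon> - \<phi> x / \<epsilon> > 1"
        using \<phi>_gap[of x y] xy eps by (simp add: diff_divide_distrib[symmetric])
      moreover have "\<lfloor>\<phi> x / \<epsilon>\<rfloor> = \<lfloor>\<phi> y / \<epsilon>\<rfloor>" using eq by simp
      ultimately show False by linarith
    qed
  qed auto
  moreover have "(\<lambda>x. (c x, \<lfloor>\<phi> x / \<epsilon>\<rfloor>)) ` E \<subseteq> C \<times> R"
  proof
    fix z assume "z \<in> (\<lambda>x. (c x, \<lfloor>\<phi> x / \<epsilon>\<rfloor>)) ` E"
    then obtain x where x: "x \<in> E" "z = (c x, \<lfloor>\<phi> x / \<epsilon>\<rfloor>)" by auto
    have "- (real k / \<epsilon>) \<le> \<phi> x / \<epsilon>" "\<phi> x / \<epsilon> \<le> real k / \<epsilon>"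
      using \<phi>_bound[OF x(1)] eps by (auto simp: field_simps)
    then show "z \<in> C \<times> R" using x C(2) by (auto simp: R_def intro: floor_mono)
  qed
  ultimately have "card E \<le> card (C \<times> R)"
    using C(1) by (intro card_inj_on_le) (auto simp: R_def)
  then have "real (card E) \<le> real (card C) * real (card R)"
    by (simp add: card_cartesian_product flip: of_nat_mult)
  also have "\<dots> \<le> real (card C) * (2 * real k / \<epsilon> + 3)"
  proof (intro mult_left_mono)
    have "real k / \<epsilon> \<ge> 0" using eps by simp
    then show "real (card R) \<le> 2 * real k / \<epsilon> + 3" unfolding R_def by simp linarith
  qed auto
  finally show ?thesis .
qed

section \<open>Laps and itineraries of the piecewise linear map\<close>

lemma locate_subinterval:
  fixes q :: "nat \<Rightarrow> 'a::linorder"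
  assumes "l < h" "q l \<le> y" "y \<le> q h"
  shows "\<exists>t. l \<le> t \<and> t < h \<and> q t \<le> y \<and> y \<le> q (Suc t)"
  using assms
proof (induction h)
  case (Suc h)
  show ?case
  proof (cases "q h \<le> y")
    case True
    then show ?thesis using Suc.prems by (intro exI[of _ h]) auto
  next
    case False
    then have "l \<noteq> h" using Suc.prems by auto
    then show ?thesis using Suc False by (metis less_Suc_eq nle_le)
  qed
qed simp

text \<open>A component outside \<open>{q 1..q n}\<close> omits the marked endpoint; continuity
  extends the constancy to it.\<close>

lemma constant_on_closed_interval:
  fixes f :: "real \<Rightarrow> real"
  assumes "continuous_on {0..1} f" "0 \<le> l" "l < u" "u \<le> 1" "f constant_on S" "{l<..<u} \<subseteq> S"
    and "x \<in> {l..u}" "y \<in> {l..u}"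
  shows "f x = f y"
proof -
  have "f constant_on {l<..<u}" using assms(5,6) by (rule constant_on_subset)
  then have "f constant_on (closure {l<..<u})"
    by (rule constant_on_closureI) (rule continuous_on_subset[OF assms(1)], use assms in auto)
  then show ?thesis using assms by (auto simp: constant_on_def closure_greaterThanLessThan)
qed

locale tau_linear_map =
  fixes n :: nat and \<tau> :: "nat \<Rightarrow> nat" and f :: "real \<Rightarrow> real" and q :: "nat \<Rightarrow> real"
  assumes n_pos: "0 < n" and perm: "\<tau> permutes {1..n}"
    and cont: "continuous_on {0..1} f" and inv: "f ` {0..1} \<subseteq> {0..1}"
    and q_mono: "strict_mono_on {1..n} q" and q_unit: "q ` {1..n} \<subseteq> {0..1}"
    and f_q: "\<And>i. i \<in> {1..n} \<Longrightarrow> f (q i) = q (\<tau> i)"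
    and f_affine: "\<And>i. i \<in> {1..<n} \<Longrightarrow> \<exists>a b. \<forall>x\<in>{q i..q (Suc i)}. f x = a * x + b"
    and f_const: "\<And>C. C \<in> components ({0..1} - {q 1..q n}) \<Longrightarrow> f constant_on C"
begin

lemma tau_in: "i \<in> {1..n} \<Longrightarrow> \<tau> i \<in> {1..n}"
  using perm by (meson permutes_in_image)

lemma q_le: "i \<in> {1..n} \<Longrightarrow> j \<in> {1..n} \<Longrightarrow> i \<le> j \<Longrightarrow> q i \<le> q j"
  using q_mono by (metis order_le_less strict_mono_onD)

lemma q_bounds: "i \<in> {1..n} \<Longrightarrow> 0 \<le> q i \<and> q i \<le> 1"
  using q_unit by force

text \<open>Index 0 and the indices from \<open>n\<close> on denote the pieces outside
  \<open>[q 1, q n]\<close>. All laps are closed, so neighbours share endpoints and itineraries need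
  not be unique.\<close>

definition lap :: "nat \<Rightarrow> real set" where
  "lap i = (if i = 0 then {0..q 1} else if i < n then {q i..q (Suc i)} else {q n..1})"

lemma constant_outside:
  assumes "i = 0 \<or> i = n" "x \<in> lap i" "y \<in> lap i"
  shows "f x = f y"
proof -
  define l u where "l = (if i = 0 then 0 else q n)" and "u = (if i = 0 then q 1 else 1)"
  have lap: "lap i = {l..u}" using assms(1) n_pos by (auto simp: lap_def l_def u_def)
  show ?thesis
  proof (cases "l < u")
    case True
    have lu: "0 \<le> l" "u \<le> 1" using q_bounds[of 1] q_bounds[of n] n_pos by (auto simp: l_def u_def)
    have "{l<..<u} \<subseteq> {0..1} - {q 1..q n}"
      using lu assms(1) n_pos by (auto simp: l_def u_def split: if_splits)
    moreover have "(l + u) / 2 \<in> {l<..<u}" using True by simp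
    ultimately have "{l<..<u} \<subseteq> {0..1} - {q 1..q n}" "{0..1} - {q 1..q n} \<noteq> {}"
      by blast+
    then obtain C where C: "C \<in> components ({0..1} - {q 1..q n})" "{l<..<u} \<subseteq> C"
      using exists_component_superset[of "{l<..<u}" "{0..1} - {q 1..q n}"] connected_Ioo by blast
    then show ?thesis
      using assms(2,3) lap
      by (intro constant_on_closed_interval[OF cont lu(1) True lu(2) f_const[OF C(1)] C(2)]) simp_all
  next
    \<comment> \<open>If \<open>q 1 = 0\<close> or \<open>q n = 1\<close>, the outer piece on that
      side is a single point and there is no component to use.\<close>
    case False
    then have "x = y" using assms lap by auto
    then show ?thesis by simp
  qed
qed

lemma lap_affine: "\<exists>a. \<forall>x\<in>lap i. \<forall>y\<in>lap i. f y - f x = a * (y - x)"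
proof (cases "i \<in> {1..<n}")
  case True
  then obtain a b where "\<forall>x\<in>{q i..q (Suc i)}. f x = a * x + b" using f_affine by blast
  then show ?thesis using True by (intro exI[of _ a]) (auto simp: lap_def algebra_simps)
next
  case False
  then have *: "i = 0 \<or> i \<ge> n" by auto
  show ?thesis
  proof (intro exI[of _ 0] ballI)
    fix x y assume xy: "x \<in> lap i" "y \<in> lap i"
    \<comment> \<open>Indices beyond \<open>n\<close> name the same piece as
      \<open>n\<close>.\<close>
    have "lap i = lap (min i n)" using * n_pos by (auto simp: lap_def)
    then show "f y - f x = 0 * (y - x)"
      using constant_outside[of "min i n" y x] xy * by (auto simp: min_def split: if_splits)
  qed
qed

text \<open>An affine map sends the lap onto the segment between \<open>q (\<tau> s)\<close> and
  \<open>q (\<tau> (Suc s))\<close>, and this segment is the union of the laps that are successors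
  of \<open>s\<close>.\<close>

lemma lap_step:
  assumes "s \<in> {1..<n}" "x \<in> lap s"
  shows "\<exists>t\<in>{1..<n}. markov_edge \<tau> s t \<and> f x \<in> lap t"
proof -
  obtain a b where ab: "\<forall>x\<in>{q s..q (Suc s)}. f x = a * x + b" using f_affine assms by blast
  have x: "q s \<le> x" "x \<le> q (Suc s)" using assms by (auto simp: lap_def)
  define l h where "l = min (\<tau> s) (\<tau> (Suc s))" and "h = max (\<tau> s) (\<tau> (Suc s))"
  have s: "s \<in> {1..n}" "Suc s \<in> {1..n}" using assms by auto
  have lh_in: "l \<in> {1..n}" "h \<in> {1..n}" using tau_in s unfolding l_def h_def by (metis min_def, metis max_def)
  have "\<tau> s \<noteq> \<tau> (Suc s)" using permutes_inj[OF perm] by (metis injD n_not_Suc_n)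
  then have lh: "l < h" by (auto simp: l_def h_def)
  have e: "f (q s) = q (\<tau> s)" "f (q (Suc s)) = q (\<tau> (Suc s))" using f_q s by auto
  have fx: "f x = a * x + b" "q (\<tau> s) = a * q s + b" "q (\<tau> (Suc s)) = a * q (Suc s) + b"
    using ab x e by auto
  have "min (q (\<tau> s)) (q (\<tau> (Suc s))) \<le> f x \<and> f x \<le> max (q (\<tau> s)) (q (\<tau> (Suc s)))"
  proof (cases "a \<ge> 0")
    case True
    then have "a * q s \<le> a * x" "a * x \<le> a * q (Suc s)" using x by (auto intro: mult_left_mono)
    then show ?thesis using fx by auto
  next
    case False
    then have "a * q s \<ge> a * x" "a * x \<ge> a * q (Suc s)" using x by (auto intro: mult_left_mono_neg)
    then show ?thesis using fx by auto
  qed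
  moreover have "q l \<le> q (\<tau> s)" "q l \<le> q (\<tau> (Suc s))" "q (\<tau> s) \<le> q h" "q (\<tau> (Suc s)) \<le> q h"
    using q_le tau_in s lh_in by (auto simp: l_def h_def)
  ultimately have "q l \<le> f x" "f x \<le> q h" by auto
  from locate_subinterval[OF lh this] obtain t where "l \<le> t" "t < h" "q t \<le> f x" "f x \<le> q (Suc t)"
    by blast
  then show ?thesis
    using lh_in by (intro bexI[of _ t]) (auto simp: lap_def markov_edge_def l_def h_def)
qed

text \<open>Iteration of \<open>lap_step\<close>; the clause on \<open>hd w\<close> supplies the
  edge needed to prepend a vertex.\<close>

lemma path_from_lap:
  assumes "s \<in> {1..<n}" "x \<in> lap s"
  shows "\<exists>w\<in>markov_paths n \<tau> (Suc k). hd w = s \<and> (\<forall>j\<le>k. (f ^^ j) x \<in> lap (w ! j))"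
  using assms
proof (induction k arbitrary: s x)
  case 0
  then show ?case by (intro bexI[of _ "[s]"]) (auto simp: markov_paths_def)
next
  case (Suc k)
  obtain t where t: "t \<in> {1..<n}" "markov_edge \<tau> s t" "f x \<in> lap t"
    using lap_step[OF Suc.prems] by blast
  obtain w where w: "w \<in> markov_paths n \<tau> (Suc k)" "hd w = t" "\<forall>j\<le>k. (f ^^ j) (f x) \<in> lap (w ! j)"
    using Suc.IH[OF t(1,3)] by blast
  have "s # w \<in> markov_paths n \<tau> (Suc (Suc k))"
    using w t Suc.prems by (auto simp: markov_paths_def successively_Cons)
  moreover have "(f ^^ j) x \<in> lap ((s # w) ! j)" if "j \<le> Suc k" for j
    using that w(3) Suc.prems by (cases j) (auto simp: funpow_swap1)
  ultimately show ?case by (intro bexI[of _ "s # w"]) auto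
qed

lemma path_from_point:
  assumes "1 < n" "q 1 \<le> x" "x \<le> q n" "0 < k"
  shows "\<exists>w\<in>markov_paths n \<tau> k. (\<forall>j<k. (f ^^ j) x \<in> lap (w ! j))"
proof -
  obtain t where "1 \<le> t" "t < n" "q t \<le> x" "x \<le> q (Suc t)"
    using locate_subinterval[of 1 n q x] assms by blast
  then have "t \<in> {1..<n}" "x \<in> lap t" by (auto simp: lap_def)
  then obtain w where "w\<in>markov_paths n \<tau> (Suc (k - 1))" "\<forall>j\<le>k-1. (f ^^ j) x \<in> lap (w ! j)"
    using path_from_lap by blast
  then show ?thesis using assms(4) by (intro bexI[of _ w]) auto
qed

lemma lap_cover:
  assumes "x \<in> {0..1}"
  shows "\<exists>i\<le>n. x \<in> lap i"
proof -
  consider "x \<le> q 1" | "q 1 \<le> x" "x \<le> q n" "1 < n" | "q n \<le> x"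
  proof -
    have "x \<le> q 1 \<or> (q 1 \<le> x \<and> x \<le> q n \<and> 1 < n) \<or> q n \<le> x"
      using n_pos by (cases "n = 1") (simp_all, linarith+)
    then show thesis using that by blast
  qed
  then show ?thesis
  proof cases
    case 1 then show ?thesis using assms by (intro exI[of _ 0]) (auto simp: lap_def)
  next
    case 2
    then obtain t where "1 \<le> t" "t < n" "q t \<le> x" "x \<le> q (Suc t)"
      using locate_subinterval[of 1 n q x] by blast
    then show ?thesis by (intro exI[of _ t]) (simp add: lap_def)
  next
    case 3 then show ?thesis using assms n_pos by (intro exI[of _ n]) (auto simp: lap_def)
  qed
qed

text \<open>An inner lap is sent into a union of inner laps, and an outer piece to the image of its
  marked endpoint. Hence from time 1 on every orbit stays in the range of the marked points.\<close>

lemma f_range: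
  assumes "x \<in> {0..1}"
  shows "q 1 \<le> f x" "f x \<le> q n"
proof -
  obtain i where i: "i \<le> n" "x \<in> lap i" using lap_cover assms by blast
  have tau_q: "q 1 \<le> q (\<tau> j) \<and> q (\<tau> j) \<le> q n" if "j \<in> {1..n}" for j
    using tau_in[OF that] q_le[of 1 "\<tau> j"] q_le[of "\<tau> j" n] by auto
  have "q 1 \<le> f x \<and> f x \<le> q n"
  proof (cases "i \<in> {1..<n}")
    case True
    then obtain t where t: "t \<in> {1..<n}" "f x \<in> lap t" using lap_step i by blast
    then show ?thesis using q_le[of 1 t] q_le[of "Suc t" n] by (auto simp: lap_def)
  next
    case False
    then have "i = 0 \<or> i = n" using i by auto
    moreover define j where "j = (if i = 0 then 1 else n)"
    moreover have j: "j \<in> {1..n}" using n_pos by (auto simp: j_def)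
    ultimately have "q j \<in> lap i" using q_bounds[of j] n_pos by (auto simp: lap_def)
    then have "f x = f (q j)" using constant_outside \<open>i = 0 \<or> i = n\<close> i by blast
    then show ?thesis using f_q[OF j] tau_q[OF j] by simp
  qed
  then show "q 1 \<le> f x" "f x \<le> q n" by auto
qed

text \<open>For \<open>n = 1\<close> the Markov graph is empty, but the fixed point \<open>q 1\<close> lies in \<open>lap 0\<close>.\<close>
definition words :: "nat \<Rightarrow> nat list set" where
  "words k = (if n = 1 then {replicate k 0} else markov_paths n \<tau> k)"

text \<open>The points outside \<open>[q 1, q n]\<close> have no itinerary in the Markov graph, but their images do.\<close>
lemma itinerary_exists:
  assumes "x \<in> {0..1}" "0 < k"
  shows "\<exists>v\<in>(\<lambda>(i, w). i # w) ` ({0..n} \<times> words k). \<forall>j<k. (f ^^ j) x \<in> lap (v ! j)"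
proof -
  obtain i where i: "i \<le> n" "x \<in> lap i" using lap_cover assms by blast
  \<comment> \<open>The word describes the orbit of \<open>f x\<close>; prefixed with the lap of
    \<open>x\<close> it is one letter longer than required.\<close>
  obtain w where w: "w \<in> words k" "\<forall>j<k. (f ^^ j) (f x) \<in> lap (w ! j)"
  proof (cases "n = 1")
    case True
    have "f (q 1) = q 1" using True f_q[of 1] tau_in[of 1] by auto
    then have "(f ^^ j) (q 1) = q 1" for j by (induction j) auto
    moreover have "f x = q 1" using f_range[OF assms(1)] True by auto
    moreover have "q 1 \<in> lap 0" using q_bounds[of 1] n_pos by (auto simp: lap_def)
    ultimately have "\<forall>j<k. (f ^^ j) (f x) \<in> lap (replicate k 0 ! j)" by simp
    moreover have "replicate k 0 \<in> words k" unfolding words_def using True by simp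
    ultimately show ?thesis using that by blast
  next
    case False
    then show ?thesis
      using path_from_point[of "f x" k] f_range[OF assms(1)] assms(2) n_pos that by (auto simp: words_def)
  qed
  have "(f ^^ j) x \<in> lap ((i # w) ! j)" if "j < k" for j
    using that w(2) i by (cases j) (auto simp: funpow_swap1)
  then show ?thesis using i w(1) by (intro bexI[of _ "i # w"]) auto
qed

text \<open>The factor \<open>n + 1\<close> counts the laps for the point itself,
  \<open>words k\<close> describes the orbit of its image, and the last factor bounds the number of
  separated points with one itinerary.\<close>

lemma separated_card_le:
  assumes "0 < k" "0 < \<epsilon>" "finite E" "separated {0..1} f k \<epsilon> E"
  shows "real (card E) \<le> real (n + 1) * real (card (words k)) * (2 * real k / \<epsilon> + 3)"
proof -
  let ?C = "(\<lambda>(i, w). i # w) ` ({0..n} \<times> words k)"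
  have fw: "finite (words k)" by (simp add: words_def finite_markov_paths)
  obtain a where a: "\<And>i x y. x \<in> lap i \<Longrightarrow> y \<in> lap i \<Longrightarrow> f y - f x = a i * (y - x)"
    using lap_affine by metis
  have "E \<subseteq> {0..1}" using assms by (simp add: separated_def)
  then obtain c where c: "\<And>x. x \<in> E \<Longrightarrow> c x \<in> ?C" "\<And>x j. x \<in> E \<Longrightarrow> j < k \<Longrightarrow> (f ^^ j) x \<in> lap (c x ! j)"
    using itinerary_exists[OF _ assms(1)] by (metis subsetD)
  have "real (card E) \<le> real (card ?C) * (2 * real k / \<epsilon> + 3)"
  proof (rule separated_card_le_itineraries[OF assms(3,4,2) inv a c(2)])
    show "finite ?C" using fw by simp
    show "c ` E \<subseteq> ?C" using c(1) by blast
  qed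
  also have "card ?C \<le> (n + 1) * card (words k)"
    using card_image_le[of "{0..n} \<times> words k" "\<lambda>(i, w). i # w"] fw by (simp add: card_cartesian_product)
  then have "real (card ?C) \<le> real (n + 1) * real (card (words k))"
    by (metis of_nat_le_iff of_nat_mult)
  then have "real (card ?C) * (2 * real k / \<epsilon> + 3) \<le> real (n + 1) * real (card (words k)) * (2 * real k / \<epsilon> + 3)"
    using assms(2) by (intro mult_right_mono) auto
  finally show ?thesis .
qed

text \<open>Apart from the number of words the cardinality bound is polynomial in \<open>k\<close>,
  so only the words contribute to the growth rate.\<close>

lemma log_max_separated_le:
  assumes "0 < k" "0 < \<epsilon>"
  shows "log_max_separated {0..1} f k \<epsilon> \<le>
    ereal (ln (real (card (words k))) + ln (real (n + 1)) + ln (2 * real k / \<epsilon> + 3))"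
proof (rule log_max_separated_leI)
  have pos: "2 * real k / \<epsilon> + 3 \<ge> 1" using assms by (simp add: add_increasing)
  fix E assume E: "finite E" "E \<noteq> {}" "separated {0..1} f k \<epsilon> E"
  note le = separated_card_le[OF assms E(1,3)]
  have "card E > 0" using E by (simp add: card_gt_0_iff)
  then have "card (words k) > 0" using le by (cases "card (words k) = 0") auto
  then have "ln (real (card E)) \<le> ln (real (n + 1) * real (card (words k)) * (2 * real k / \<epsilon> + 3))"
    using le \<open>card E > 0\<close> by (subst ln_le_cancel_iff) auto
  also have "\<dots> = ln (real (card (words k))) + ln (real (n + 1)) + ln (2 * real k / \<epsilon> + 3)"
    using \<open>card (words k) > 0\<close> pos by (simp add: ln_mult_pos)
  finally show "ereal (ln (real (card E))) \<le>
    ereal (ln (real (card (words k))) + ln (real (n + 1)) + ln (2 * real k / \<epsilon> + 3))" by simp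
next
  have pos: "2 * real k / \<epsilon> + 3 \<ge> 1" using assms by (simp add: add_increasing)
  have "0 \<le> ln (real (card (words k)))"
    by (cases "card (words k) = 0") auto
  then show "0 \<le> ereal (ln (real (card (words k))) + ln (real (n + 1)) + ln (2 * real k / \<epsilon> + 3))"
    using pos by auto
qed

end

section \<open>Paths realized between strips\<close>

lemma rot_funpow: "(rot \<omega> ^^ k) \<theta> = cis (2 * pi * \<omega>) ^ k * \<theta>"
  by (induction k) (simp_all add: rot_def)

lemma rot_funpow_in_circle: "\<theta> \<in> circle \<Longrightarrow> (rot \<omega> ^^ k) \<theta> \<in> circle"
  by (induction k) (simp_all add: rot_in_circle)

text \<open>Baire's theorem on the circle, applied to the preimages of the given dense open sets
  under all iterates of the rotation. These are countably many, and they are open and dense because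
  a rotation is an isometry of the circle.\<close>

lemma residual_orbit_exists:
  assumes I: "countable I" and G: "\<And>i. i \<in> I \<Longrightarrow> residual_in (top_of_set circle) (G i)"
  obtains \<theta> where "\<theta> \<in> circle" "\<And>i k. i \<in> I \<Longrightarrow> (rot \<omega> ^^ k) \<theta> \<in> G i"
proof -
  have "\<exists>\<U>. countable \<U> \<and> (\<forall>U\<in>\<U>. openin (top_of_set circle) U \<and> top_of_set circle closure_of U = circle) \<and>
     circle \<inter> \<Inter>\<U> \<subseteq> G i" if "i \<in> I" for i
    using G[OF that] unfolding residual_in_def by auto
  then obtain \<U> where \<U>: "\<And>i. i \<in> I \<Longrightarrow> countable (\<U> i)"
    "\<And>i U. i \<in> I \<Longrightarrow> U \<in> \<U> i \<Longrightarrow> openin (top_of_set circle) U \<and> top_of_set circle closure_of U = circle"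
    "\<And>i. i \<in> I \<Longrightarrow> circle \<inter> \<Inter>(\<U> i) \<subseteq> G i"
    by metis
  define V where "V = (\<lambda>(k, U). {\<theta>\<in>circle. (rot \<omega> ^^ k) \<theta> \<in> U})"
  \<comment> \<open>Including \<open>circle\<close> keeps the intersection inside the circle, also
    for empty \<open>I\<close>.\<close>
  define H where "H = insert circle (V ` (UNIV \<times> (\<Union>i\<in>I. \<U> i)))"
  have H: "openin (top_of_set circle) T \<and> circle \<subseteq> closure T" if "T \<in> H" for T
  proof (cases "T = circle")
    case True
    then show ?thesis by (simp add: closure_subset)
  next
    case False
    then have "T \<in> V ` (UNIV \<times> (\<Union>i\<in>I. \<U> i))" using that by (simp add: H_def)
    then obtain k i U where T: "T = V (k, U)" "i \<in> I" "U \<in> \<U> i" by blast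
    let ?c = "cis (2 * pi * \<omega>) ^ k"
    have c: "norm ?c = 1" by (simp add: norm_power)
    have U: "openin (top_of_set circle) U" "top_of_set circle closure_of U = circle" using \<U>(2) T by auto
    have Uc: "U \<subseteq> circle" using U(1) by (rule openin_imp_subset)
    have "circle \<inter> closure U = circle"
      using U(2) Uc by (simp add: closure_of_subtopology Int_absorb1)
    then have dense: "circle \<subseteq> closure U" by blast
    have "T = circle \<inter> (\<lambda>\<theta>. ?c * \<theta>) -` U" using T(1) by (auto simp: V_def rot_funpow)
    moreover have "openin (top_of_set circle) (circle \<inter> (\<lambda>\<theta>. ?c * \<theta>) -` U)"
      using U(1) c
      by (intro continuous_openin_preimage[where T = circle])
         (auto simp: circle_def norm_mult intro!: continuous_intros)
    moreover have "x \<in> closure T" if x: "x \<in> circle" for x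
      unfolding closure_approachable
    proof (intro allI impI)
      fix e :: real assume "0 < e"
      have "?c * x \<in> circle" using x c by (simp add: circle_def norm_mult)
      then obtain v where v: "v \<in> U" "dist v (?c * x) < e"
        using dense \<open>0 < e\<close> by (meson closure_approachable subsetD)
      \<comment> \<open>Rotating the approximating point \<open>v\<close> back gives a point of
        \<open>T\<close> at the same distance from \<open>x\<close>.\<close>
      have "v / ?c \<in> T"
        using v(1) Uc c by (auto simp: T(1) V_def rot_funpow circle_def norm_divide)
      moreover have "dist (v / ?c) x = dist v (?c * x)"
      proof -
        have "v - ?c * x = ?c * (v / ?c - x)" by (simp add: field_simps)
        then show ?thesis using c by (metis dist_norm mult_1 norm_mult)
      qed
      ultimately show "\<exists>y\<in>T. dist y x < e" using v(2) by metis
    qed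
    ultimately show ?thesis by auto
  qed
  have "countable H" unfolding H_def using I \<U>(1) by auto
  then have "circle \<subseteq> closure (\<Inter>H)"
    using H by (intro Baire) (auto simp: circle_def)
  then have "\<Inter>H \<noteq> {}" using one_in_circle by auto
  then obtain \<theta> where \<theta>: "\<theta> \<in> \<Inter>H" by auto
  then have "\<theta> \<in> circle" by (auto simp: H_def)
  moreover have "(rot \<omega> ^^ k) \<theta> \<in> G i" if "i \<in> I" for i k
  proof -
    have "(rot \<omega> ^^ k) \<theta> \<in> U" if "U \<in> \<U> i" for U
      using \<theta> \<open>i \<in> I\<close> that by (force simp: H_def V_def)
    then show ?thesis using \<U>(3)[OF that] rot_funpow_in_circle[OF \<open>\<theta> \<in> circle\<close>] by blast
  qed
  ultimately show ?thesis using that by blast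
qed

text \<open>Fibres are projections of compact slices, hence compact.\<close>

lemma fibre_extrema:
  assumes "compact B" "\<theta> \<in> fst ` B"
  shows "(\<theta>, strip_max B \<theta>) \<in> B" "(\<theta>, strip_min B \<theta>) \<in> B"
    "\<And>x. (\<theta>, x) \<in> B \<Longrightarrow> strip_min B \<theta> \<le> x \<and> x \<le> strip_max B \<theta>"
proof -
  have "fibre B \<theta> = snd ` (B \<inter> ({\<theta>} \<times> UNIV))" by (force simp: fibre_def)
  moreover have "compact (B \<inter> ({\<theta>} \<times> UNIV))"
    using assms(1) by (intro compact_Int_closed closed_Times) auto
  ultimately have "compact (fibre B \<theta>)"
    by (simp add: compact_continuous_image continuous_on_snd)
  moreover have ne: "fibre B \<theta> \<noteq> {}" using assms(2) by (auto simp: fibre_def)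
  ultimately have bdd: "bdd_above (fibre B \<theta>)" "bdd_below (fibre B \<theta>)" and cl: "closed (fibre B \<theta>)"
    by (auto simp: compact_imp_closed compact_imp_bounded bounded_imp_bdd_above bounded_imp_bdd_below)
  show "(\<theta>, strip_max B \<theta>) \<in> B" "(\<theta>, strip_min B \<theta>) \<in> B"
    using closed_contains_Sup[OF ne bdd(1) cl] closed_contains_Inf[OF ne bdd(2) cl]
    by (auto simp: strip_max_def strip_min_def fibre_def)
  show "strip_min B \<theta> \<le> x \<and> x \<le> strip_max B \<theta>" if "(\<theta>, x) \<in> B" for x
    using that bdd by (auto simp: strip_max_def strip_min_def fibre_def intro: cSup_upper cInf_lower)
qed

text \<open>A greedy choice of representatives. It replaces equivalence classes because
  \<open>R\<close> will be closeness of orbits at a fixed scale, which need not be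
  transitive.\<close>

lemma maximal_unrelated_subset:
  assumes "finite W" "\<And>w. R w w" "\<And>v w. R v w \<Longrightarrow> R w v"
  shows "\<exists>V\<subseteq>W. (\<forall>v\<in>V. \<forall>v'\<in>V. v \<noteq> v' \<longrightarrow> \<not> R v v') \<and> (\<forall>w\<in>W. \<exists>v\<in>V. R v w)"
  using assms(1)
proof (induction W)
  case (insert w W)
  then obtain V where V: "V \<subseteq> W" "\<forall>v\<in>V. \<forall>v'\<in>V. v \<noteq> v' \<longrightarrow> \<not> R v v'" "\<forall>w\<in>W. \<exists>v\<in>V. R v w" by blast
  show ?case
  proof (cases "\<exists>v\<in>V. R v w")
    case True
    then show ?thesis using V by (intro exI[of _ V]) auto
  next
    case False
    then have "\<forall>v\<in>V. \<not> R v w \<and> \<not> R w v" using assms(3) by metis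
    then have "\<forall>v\<in>insert w V. \<forall>v'\<in>insert w V. v \<noteq> v' \<longrightarrow> \<not> R v v'" using V(2) by auto
    moreover have "\<forall>w'\<in>insert w W. \<exists>v\<in>insert w V. R v w'" using V(3) assms(2) by auto
    ultimately show ?thesis using V(1) by (intro exI[of _ "insert w V"]) auto
  qed
qed simp

text \<open>The image of an interval with endpoint \<open>c\<close> extends from
  \<open>\<tau> c\<close> to one side only, so it covers only one of the two intervals adjacent to
  \<open>\<tau> c\<close>.\<close>

lemma markov_edge_unique:
  assumes "markov_edge \<tau> s t" "markov_edge \<tau> s t'" "s = c \<or> Suc s = c"
    and "t = \<tau> c \<or> Suc t = \<tau> c" "t' = \<tau> c \<or> Suc t' = \<tau> c"
  shows "t = t'"
  using assms by (auto simp: markov_edge_def min_def max_def split: if_splits)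

lemma markov_paths_nth: "w \<in> markov_paths n \<tau> k \<Longrightarrow> i < k \<Longrightarrow> w ! i \<in> {1..<n}"
  unfolding markov_paths_def by (metis (mono_tags, lifting) mem_Collect_eq nth_mem subsetD)

lemma markov_paths_edge: "w \<in> markov_paths n \<tau> k \<Longrightarrow> Suc i < k \<Longrightarrow> markov_edge \<tau> (w ! i) (w ! Suc i)"
  by (simp add: markov_paths_def successively_conv_nth)

text \<open>The strips over a single orbit \<open>\<theta>\<close> of base points, in all of whose
  fibres neighbouring strips are in strict order. The uniform bound \<open>\<delta>\<close> will
  come from disjointness and compactness of the strips.\<close>

locale strip_orbit =
  fixes F :: "complex \<times> real \<Rightarrow> complex \<times> real" and \<theta> :: "nat \<Rightarrow> complex"
    and B :: "nat \<Rightarrow> (complex \<times> real) set" and n :: nat and \<tau> :: "nat \<Rightarrow> nat" and \<delta> :: real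
  assumes perm: "\<tau> permutes {1..n}"
    and cont: "continuous_on cylinder F" and inv: "F ` cylinder \<subseteq> cylinder"
    and base: "\<And>j. \<theta> j \<in> circle"
    and base_step: "\<And>j x. x \<in> {0..1} \<Longrightarrow> fst (F (\<theta> j, x)) = \<theta> (Suc j)"
    and B_compact: "\<And>i. i \<in> {1..n} \<Longrightarrow> compact (B i)"
    and B_cyl: "\<And>i. i \<in> {1..n} \<Longrightarrow> B i \<subseteq> cylinder"
    and B_base: "\<And>i. i \<in> {1..n} \<Longrightarrow> fst ` B i = circle"
    and F_B: "\<And>i. i \<in> {1..n} \<Longrightarrow> F ` B i \<subseteq> B (\<tau> i)"
    and less: "\<And>i j. i \<in> {1..<n} \<Longrightarrow> strip_max (B i) (\<theta> j) < strip_min (B (Suc i)) (\<theta> j)"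
    and \<delta>_pos: "\<delta> > 0"
    and dist_B: "\<And>i u v. i \<in> {1..<n} \<Longrightarrow> u \<in> B i \<Longrightarrow> v \<in> B (Suc i) \<Longrightarrow> \<delta> \<le> dist u v"
begin

section \<open>Gaps between neighbouring strips\<close>

definition hi :: "nat \<Rightarrow> nat \<Rightarrow> real" where "hi j i = strip_max (B i) (\<theta> j)"
definition lo :: "nat \<Rightarrow> nat \<Rightarrow> real" where "lo j i = strip_min (B i) (\<theta> j)"

text \<open>The counterpart over \<open>\<theta> j\<close> of the interval from \<open>q s\<close>
  to \<open>q (Suc s)\<close>. Its two endpoints lie on strips, which controls where they are
  mapped.\<close>

definition gap :: "nat \<Rightarrow> nat \<Rightarrow> (complex \<times> real) set" where
  "gap j s = {\<theta> j} \<times> {hi j s..lo j (Suc s)}"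

lemma tau_in: "i \<in> {1..n} \<Longrightarrow> \<tau> i \<in> {1..n}"
  using perm by (meson permutes_in_image)

lemma hi_lo:
  assumes "i \<in> {1..n}"
  shows "(\<theta> j, hi j i) \<in> B i" "(\<theta> j, lo j i) \<in> B i"
    "\<And>x. (\<theta> j, x) \<in> B i \<Longrightarrow> lo j i \<le> x \<and> x \<le> hi j i"
  using fibre_extrema[OF B_compact[OF assms], of "\<theta> j"] base B_base[OF assms]
  by (auto simp: hi_def lo_def)

lemma lo_le_hi: "i \<in> {1..n} \<Longrightarrow> lo j i \<le> hi j i"
  using hi_lo by blast

text \<open>Both edges lie in one fibre, so their distance in the cylinder is a distance of reals,
  and the order of the strips gives its sign.\<close>

lemma gap_length:
  assumes "i \<in> {1..<n}"
  shows "hi j i + \<delta> \<le> lo j (Suc i)"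
proof -
  have i: "i \<in> {1..n}" "Suc i \<in> {1..n}" using assms by auto
  have "\<delta> \<le> \<bar>hi j i - lo j (Suc i)\<bar>"
    using dist_B[OF assms hi_lo(1)[OF i(1), of j] hi_lo(2)[OF i(2), of j]] by (simp add: dist_Pair_Pair dist_real_def)
  then show ?thesis using less[OF assms, of j] by (simp add: hi_def lo_def)
qed

lemma hi_mono: "1 \<le> i \<Longrightarrow> i \<le> k \<Longrightarrow> k \<le> n \<Longrightarrow> hi j i \<le> hi j k"
proof (induction k)
  case (Suc k)
  show ?case
  proof (cases "i = Suc k")
    case False
    then have "hi j i \<le> hi j k" using Suc by auto
    then show ?thesis using gap_length[of k j] lo_le_hi[of "Suc k" j] Suc.prems False \<delta>_pos by auto
  qed simp
qed simp

lemma lo_mono: "1 \<le> i \<Longrightarrow> i \<le> k \<Longrightarrow> k \<le> n \<Longrightarrow> lo j i \<le> lo j k"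
proof (induction k)
  case (Suc k)
  show ?case
  proof (cases "i = Suc k")
    case False
    then have "lo j i \<le> lo j k" using Suc by auto
    then show ?thesis using gap_length[of k j] lo_le_hi[of k j] Suc.prems False \<delta>_pos by auto
  qed simp
qed simp

lemma strips_apart:
  assumes "1 \<le> c" "c < d" "d \<le> n" "(\<theta> j, x) \<in> B c" "(\<theta> j, y) \<in> B d"
  shows "x + \<delta> \<le> y"
  using hi_lo(3)[of c j x] hi_lo(3)[of d j y] gap_length[of c j] lo_mono[of "Suc c" d j] assms by auto

lemma gap_subset_cylinder:
  assumes "s \<in> {1..<n}"
  shows "gap j s \<subseteq> cylinder"
proof -
  have "(\<theta> j, hi j s) \<in> cylinder" "(\<theta> j, lo j (Suc s)) \<in> cylinder"
    using hi_lo(1)[of s j] hi_lo(2)[of "Suc s" j] B_cyl[of s] B_cyl[of "Suc s"] assms by auto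
  then show ?thesis by (auto simp: gap_def cylinder_def unit_interval_def)
qed

text \<open>The endpoints of the gap lie on the strips \<open>s\<close> and \<open>Suc s\<close>,
  hence their images lie on the strips \<open>\<tau> s\<close> and \<open>\<tau> (Suc s)\<close>. An
  edge to \<open>t\<close> says that gap \<open>t\<close> lies between these two, so the
  intermediate value theorem applies.\<close>

lemma gap_covers:
  assumes s: "s \<in> {1..<n}" and st: "markov_edge \<tau> s t"
  shows "gap (Suc j) t \<subseteq> F ` gap j s"
proof
  fix v assume "v \<in> gap (Suc j) t"
  then obtain y where v: "v = (\<theta> (Suc j), y)" and y: "hi (Suc j) t \<le> y" "y \<le> lo (Suc j) (Suc t)"
    by (auto simp: gap_def)
  define h where "h = (\<lambda>x. snd (F (\<theta> j, x)))"
  define a b where "a = hi j s" and "b = lo j (Suc s)"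
  have s': "s \<in> {1..n}" "Suc s \<in> {1..n}" using s by auto
  have ab: "a \<le> b" using gap_length[OF s, of j] \<delta>_pos by (simp add: a_def b_def)
  have seg: "(\<theta> j, x) \<in> cylinder" if "x \<in> {a..b}" for x
    using gap_subset_cylinder[OF s, of j] that by (auto simp: gap_def a_def b_def)
  then have h: "F (\<theta> j, x) = (\<theta> (Suc j), h x)" if "x \<in> {a..b}" for x
    using base_step[of x j] that by (auto simp: h_def cylinder_def unit_interval_def prod_eq_iff)
  have "continuous_on {a..b} h"
    unfolding h_def using seg
    by (intro continuous_on_snd continuous_on_compose2[OF cont] continuous_intros) auto
  have "F (\<theta> j, a) \<in> B (\<tau> s)" "F (\<theta> j, b) \<in> B (\<tau> (Suc s))"
    using F_B hi_lo s' unfolding a_def b_def by blast+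
  then have ha: "lo (Suc j) (\<tau> s) \<le> h a \<and> h a \<le> hi (Suc j) (\<tau> s)"
    and hb: "lo (Suc j) (\<tau> (Suc s)) \<le> h b \<and> h b \<le> hi (Suc j) (\<tau> (Suc s))"
    using hi_lo(3)[OF tau_in] s' h[of a] h[of b] ab by auto
  have \<tau>s: "\<tau> s \<in> {1..n}" "\<tau> (Suc s) \<in> {1..n}" using tau_in s' by auto
  have "\<exists>x\<in>{a..b}. h x = y"
  proof (cases "\<tau> s < \<tau> (Suc s)")
    case True
    then have "\<tau> s \<le> t" "Suc t \<le> \<tau> (Suc s)" using st by (auto simp: markov_edge_def)
    then have "h a \<le> y" "y \<le> h b"
      using ha hb y hi_mono[of "\<tau> s" t "Suc j"] lo_mono[of "Suc t" "\<tau> (Suc s)" "Suc j"] \<tau>s by auto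
    then show ?thesis using IVT'[of h a y b] ab \<open>continuous_on {a..b} h\<close> by auto
  next
    case False
    then have "\<tau> (Suc s) \<le> t" "Suc t \<le> \<tau> s" using st by (auto simp: markov_edge_def)
    then have "h b \<le> y" "y \<le> h a"
      using ha hb y hi_mono[of "\<tau> (Suc s)" t "Suc j"] lo_mono[of "Suc t" "\<tau> s" "Suc j"] \<tau>s by auto
    then show ?thesis using IVT2'[of h b y a] ab \<open>continuous_on {a..b} h\<close> by auto
  qed
  then obtain x where "x \<in> {a..b}" "h x = y" by blast
  then have "F (\<theta> j, x) = v" "(\<theta> j, x) \<in> gap j s" using h v by (auto simp: gap_def a_def b_def)
  then show "v \<in> F ` gap j s" by blast
qed

text \<open>The point is found by pulling back from the end of the path: a point realizing the tail
  over the shifted orbit has a preimage in the first gap. The induction therefore needs every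
  starting time \<open>j\<close>.\<close>

lemma path_realized:
  assumes "w \<in> markov_paths n \<tau> k" "0 < k"
  shows "\<exists>u. \<forall>i<k. (F ^^ i) u \<in> gap (j + i) (w ! i)"
  using assms
proof (induction k arbitrary: w j)
  case (Suc k)
  then obtain s w' where w: "w = s # w'" by (cases w) (auto simp: markov_paths_def)
  have s: "s \<in> {1..<n}" using Suc.prems by (auto simp: w markov_paths_def)
  show ?case
  proof (cases "k = 0")
    case True
    have "(\<theta> j, hi j s) \<in> gap j s" using gap_length[OF s, of j] \<delta>_pos by (simp add: gap_def)
    then show ?thesis using True w by auto
  next
    case False
    then have w': "w' \<in> markov_paths n \<tau> k" "markov_edge \<tau> s (w' ! 0)"
      using Suc.prems by (auto simp: w markov_paths_def successively_Cons hd_conv_nth)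
    then obtain v where v: "\<forall>i<k. (F ^^ i) v \<in> gap (Suc j + i) (w' ! i)" using Suc.IH False by blast
    then have "v \<in> gap (Suc j) (w' ! 0)" using False by force
    then obtain u where u: "u \<in> gap j s" "F u = v" using gap_covers[OF s w'(2), of j] by blast
    have "(F ^^ i) u \<in> gap (j + i) (w ! i)" if "i < Suc k" for i
      using that u v by (cases i) (auto simp: w funpow_swap1)
    then show ?thesis by blast
  qed
qed simp

text \<open>The strip that borders gap \<open>e\<close> on the side of gap \<open>s\<close> has a
  point between \<open>x\<close> and \<open>y\<close>. A strip next to \<open>e\<close> is chosen
  because that gap will belong to a reference path with which two others are compared.\<close>

lemma strip_between:
  assumes "s \<in> {1..<n}" "e \<in> {1..<n}" "s \<noteq> e" "(\<theta> j, x) \<in> gap j s" "(\<theta> j, y) \<in> gap j e"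
  shows "\<exists>c\<in>{1..n}. (c = e \<or> c = Suc e) \<and> (\<exists>z. (\<theta> j, z) \<in> B c \<and> \<bar>x - z\<bar> \<le> \<bar>x - y\<bar> \<and> \<bar>y - z\<bar> \<le> \<bar>x - y\<bar>)"
proof -
  have x: "hi j s \<le> x" "x \<le> lo j (Suc s)" and y: "hi j e \<le> y" "y \<le> lo j (Suc e)"
    using assms by (auto simp: gap_def)
  show ?thesis
  proof (cases "s < e")
    case True
    then have "x \<le> lo j e" using x lo_mono[of "Suc s" e j] assms by auto
    moreover have "lo j e \<le> y" using y lo_le_hi[of e j] assms by auto
    moreover have "(\<theta> j, lo j e) \<in> B e" using hi_lo assms by auto
    ultimately show ?thesis using assms by (intro bexI[of _ e] conjI exI[of _ "lo j e"]) auto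
  next
    case False
    then have "hi j (Suc e) \<le> x" using x hi_mono[of "Suc e" s j] assms by auto
    moreover have "y \<le> hi j (Suc e)" using y lo_le_hi[of "Suc e" j] assms by auto
    moreover have "(\<theta> j, hi j (Suc e)) \<in> B (Suc e)" using hi_lo[of "Suc e"] assms by auto
    ultimately show ?thesis using assms by (intro bexI[of _ "Suc e"] conjI exI[of _ "hi j (Suc e)"]) auto
  qed
qed

text \<open>A strip that does not border the gap lies beyond a bordering one, at distance at least
  \<open>\<delta>\<close> from it.\<close>

lemma gap_near_strip:
  assumes "s \<in> {1..<n}" "c \<in> {1..n}" "(\<theta> j, x) \<in> gap j s" "(\<theta> j, z) \<in> B c" "\<bar>x - z\<bar> < \<delta>"
  shows "s = c \<or> Suc s = c"
proof (rule ccontr)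
  assume "\<not> (s = c \<or> Suc s = c)"
  then consider "c < s" | "Suc s < c" by linarith
  then show False
  proof cases
    case 1
    then have "z + \<delta> \<le> hi j s" using strips_apart[of c s j z "hi j s"] hi_lo(1)[of s j] assms by auto
    then show False using assms by (auto simp: gap_def)
  next
    case 2
    then have "lo j (Suc s) + \<delta> \<le> z"
      using strips_apart[of "Suc s" c j "lo j (Suc s)" z] hi_lo(2)[of "Suc s" j] assms by auto
    then show False using assms by (auto simp: gap_def)
  qed
qed

section \<open>Paths followed by nearby points\<close>

definition realizes :: "nat list \<Rightarrow> complex \<times> real \<Rightarrow> bool" where
  "realizes w u \<longleftrightarrow> (\<forall>i<length w. (F ^^ i) u \<in> gap i (w ! i))"

lemma funpow_strip:
  assumes "c \<in> {1..n}" "(\<theta> j, z) \<in> B c"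
  shows "(\<tau> ^^ r) c \<in> {1..n} \<and> (F ^^ r) (\<theta> j, z) \<in> B ((\<tau> ^^ r) c) \<and> fst ((F ^^ r) (\<theta> j, z)) = \<theta> (j + r)"
proof (induction r)
  case (Suc r)
  obtain x where x: "(F ^^ r) (\<theta> j, z) = (\<theta> (j + r), x)" using Suc by (metis prod.collapse)
  then have "(\<theta> (j + r), x) \<in> cylinder" using Suc B_cyl by auto
  then have "fst (F (\<theta> (j + r), x)) = \<theta> (Suc (j + r))" using base_step by (simp add: cylinder_def unit_interval_def)
  moreover have "F ((F ^^ r) (\<theta> j, z)) \<in> B (\<tau> ((\<tau> ^^ r) c))" using F_B Suc by blast
  moreover have "\<tau> ((\<tau> ^^ r) c) \<in> {1..n}" using tau_in Suc by blast
  ultimately show ?case using x by simp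
qed (use assms in simp)

lemma dist_same_base: "fst u = fst v \<Longrightarrow> dist u v = \<bar>snd u - snd v\<bar>" for u v :: "complex \<times> real"
  by (cases u; cases v) (simp add: dist_Pair_Pair dist_real_def)

text \<open>Once \<open>w\<close> and \<open>w'\<close> leave \<open>e\<close>, their orbits sit next to a common strip and stay next to its images,
  which leaves only one admissible continuation.\<close>
lemma shadowing_unique:
  assumes equi: "\<And>u v r. u \<in> cylinder \<Longrightarrow> v \<in> cylinder \<Longrightarrow> dist u v \<le> \<epsilon> \<Longrightarrow> r < L \<Longrightarrow>
      dist ((F ^^ r) u) ((F ^^ r) v) < \<delta>"
    and \<epsilon>: "2 * \<epsilon> < \<delta>"
    and e: "e \<in> markov_paths n \<tau> k" "realizes e p"
    and w: "w \<in> markov_paths n \<tau> k" "realizes w u" "\<And>i. i < k \<Longrightarrow> dist ((F ^^ i) u) ((F ^^ i) p) \<le> \<epsilon>"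
    and w': "w' \<in> markov_paths n \<tau> k" "realizes w' u'" "\<And>i. i < k \<Longrightarrow> dist ((F ^^ i) u') ((F ^^ i) p) \<le> \<epsilon>"
    and t: "t < k" "w ! t \<noteq> e ! t" "w' ! t \<noteq> e ! t"
    and r: "r < L" "t + r < k"
  shows "w ! (t + r) = w' ! (t + r)"
proof -
  have len: "length e = k" "length w = k" "length w' = k" using e w w' by (auto simp: markov_paths_def)
  have gw: "(F ^^ i) u \<in> gap i (w ! i)" and gw': "(F ^^ i) u' \<in> gap i (w' ! i)"
    and ge: "(F ^^ i) p \<in> gap i (e ! i)" if "i < k" for i
    using that e(2) w(2) w'(2) len by (auto simp: realizes_def)
  note nth = markov_paths_nth[OF e(1)] markov_paths_nth[OF w(1)] markov_paths_nth[OF w'(1)]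
  have near: "\<exists>c\<in>{1..n}. (c = e ! t \<or> c = Suc (e ! t)) \<and> (\<exists>z. (\<theta> t, z) \<in> B c \<and>
      dist ((F ^^ t) x) (\<theta> t, z) \<le> \<epsilon> \<and> dist ((F ^^ t) p) (\<theta> t, z) \<le> \<epsilon>)"
    if v: "v ! t \<noteq> e ! t" "v ! t \<in> {1..<n}" "(F ^^ t) x \<in> gap t (v ! t)" "dist ((F ^^ t) x) ((F ^^ t) p) \<le> \<epsilon>"
    for v x
  proof -
    obtain a where a: "(F ^^ t) x = (\<theta> t, a)" using v(3) by (auto simp: gap_def)
    obtain b where b: "(F ^^ t) p = (\<theta> t, b)" using ge[OF t(1)] by (auto simp: gap_def)
    have "\<bar>a - b\<bar> \<le> \<epsilon>" using v(4) a b by (simp add: dist_same_base)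
    then show ?thesis
      using strip_between[OF v(2) nth(1)[OF t(1)] v(1), of t a b] v(3) ge[OF t(1)] a b
      by (fastforce simp: dist_same_base)
  qed
  obtain c z where c: "c \<in> {1..n}" "c = e ! t \<or> c = Suc (e ! t)" "(\<theta> t, z) \<in> B c"
    "dist ((F ^^ t) u) (\<theta> t, z) \<le> \<epsilon>" "dist ((F ^^ t) p) (\<theta> t, z) \<le> \<epsilon>"
    using near[OF t(2) nth(2)[OF t(1)] gw[OF t(1)] w(3)[OF t(1)]] by blast
  obtain c' z' where c': "c' \<in> {1..n}" "c' = e ! t \<or> c' = Suc (e ! t)" "(\<theta> t, z') \<in> B c'"
    "dist ((F ^^ t) u') (\<theta> t, z') \<le> \<epsilon>" "dist ((F ^^ t) p) (\<theta> t, z') \<le> \<epsilon>"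
    using near[OF t(3) nth(3)[OF t(1)] gw'[OF t(1)] w'(3)[OF t(1)]] by blast
  \<comment> \<open>Both strips pass within \<open>\<epsilon>\<close> of the reference point, so
    \<open>2 * \<epsilon> < \<delta>\<close> forces them to coincide.\<close>
  have "dist (\<theta> t, z) (\<theta> t, z') \<le> 2 * \<epsilon>"
    using dist_triangle3[of "(\<theta> t, z)" "(\<theta> t, z')" "(F ^^ t) p"] c(5) c'(5) by simp
  then have "\<bar>z - z'\<bar> < \<delta>" using \<epsilon> by (simp add: dist_same_base)
  then have cc': "c = c'"
    using strips_apart[of c c' t z z'] strips_apart[of c' c t z' z] c c'
    by (cases c c' rule: linorder_cases) auto
  \<comment> \<open>For \<open>r < L\<close> equicontinuity keeps the orbit within
    \<open>\<delta>\<close> of the image strip, so the gap visited borders that strip.\<close>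
  have side: "v ! (t + r) = (\<tau> ^^ r) c \<or> Suc (v ! (t + r)) = (\<tau> ^^ r) c"
    if v: "v \<in> markov_paths n \<tau> k" "\<And>i. i < k \<Longrightarrow> (F ^^ i) x \<in> gap i (v ! i)"
      and y: "(\<theta> t, y) \<in> B c" "dist ((F ^^ t) x) (\<theta> t, y) \<le> \<epsilon>" and r: "r < L" "t + r < k" for v x y r
  proof -
    have mem: "v ! i \<in> {1..<n}" if "i < k" for i using markov_paths_nth[OF v(1) that] .
    have "(F ^^ t) x \<in> cylinder" using v(2)[OF t(1)] gap_subset_cylinder[OF mem[OF t(1)]] by blast
    moreover have "(\<theta> t, y) \<in> cylinder" using y B_cyl c(1) by blast
    ultimately have d: "dist ((F ^^ r) ((F ^^ t) x)) ((F ^^ r) (\<theta> t, y)) < \<delta>"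
      using equi y(2) r(1) by blast
    obtain b where b: "(F ^^ r) (\<theta> t, y) = (\<theta> (t + r), b)" "(\<theta> (t + r), b) \<in> B ((\<tau> ^^ r) c)"
      "(\<tau> ^^ r) c \<in> {1..n}"
      using funpow_strip[OF c(1) y(1), of r] by (metis prod.collapse)
    obtain a where a: "(F ^^ (t + r)) x = (\<theta> (t + r), a)" "(\<theta> (t + r), a) \<in> gap (t + r) (v ! (t + r))"
      using v(2)[OF r(2)] by (auto simp: gap_def)
    have "(F ^^ r) ((F ^^ t) x) = (\<theta> (t + r), a)"
      using a(1) by (simp add: add.commute[of t r] funpow_add)
    then have "\<bar>a - b\<bar> < \<delta>" using d b(1) by (simp add: dist_same_base)
    then show ?thesis using gap_near_strip[OF mem[OF r(2)] b(3) a(2) b(2)] by blast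
  qed
  note side_w = side[OF w(1) gw c(3,4)]
  note side_w' = side[OF w'(1) gw', folded cc', OF _ c'(3,4)[folded cc']]
  show ?thesis using r
  proof (induction r)
    case 0
    \<comment> \<open>At most two gaps border \<open>c\<close>, and one of them is
      \<open>e ! t\<close>, which both paths avoid at time \<open>t\<close>.\<close>
    have "w ! t = c \<or> Suc (w ! t) = c" "w' ! t = c \<or> Suc (w' ! t) = c"
      using side_w[of 0] side_w'[of 0] 0 by auto
    then show ?case using t c(2) by auto
  next
    case (Suc r)
    have eq: "w ! (t + r) = w' ! (t + r)" using Suc by auto
    have "markov_edge \<tau> (w ! (t + r)) (w ! (t + Suc r))" "markov_edge \<tau> (w ! (t + r)) (w' ! (t + Suc r))"
      using markov_paths_edge[OF w(1), of "t + r"] markov_paths_edge[OF w'(1), of "t + r"] eq Suc.prems by auto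
    then show ?case
    proof (rule markov_edge_unique)
      show "w ! (t + r) = (\<tau> ^^ r) c \<or> Suc (w ! (t + r)) = (\<tau> ^^ r) c"
        using side_w[of r] Suc.prems by auto
      show "w ! (t + Suc r) = \<tau> ((\<tau> ^^ r) c) \<or> Suc (w ! (t + Suc r)) = \<tau> ((\<tau> ^^ r) c)"
        using side_w[of "Suc r"] Suc.prems by auto
      show "w' ! (t + Suc r) = \<tau> ((\<tau> ^^ r) c) \<or> Suc (w' ! (t + Suc r)) = \<tau> ((\<tau> ^^ r) c)"
        using side_w'[of "Suc r"] Suc.prems by auto
    qed
  qed
qed

text \<open>Time is cut into \<open>k div L + 1\<close> blocks of length \<open>L\<close>, and a
  path is encoded by its first deviation from \<open>e\<close> in each block. Before the deviation
  it agrees with \<open>e\<close>; from then on \<open>shadowing_unique\<close> determines it up to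
  the end of the block. So the code is injective.\<close>

lemma shadowing_card_le:
  assumes equi: "\<And>u v r. u \<in> cylinder \<Longrightarrow> v \<in> cylinder \<Longrightarrow> dist u v \<le> \<epsilon> \<Longrightarrow> r < L \<Longrightarrow>
      dist ((F ^^ r) u) ((F ^^ r) v) < \<delta>"
    and \<epsilon>: "2 * \<epsilon> < \<delta>" and L: "L > 0"
    and P: "\<And>w. w \<in> markov_paths n \<tau> k \<Longrightarrow> realizes w (P w)"
    and e: "e \<in> markov_paths n \<tau> k"
  shows "card {w \<in> markov_paths n \<tau> k. \<forall>i<k. dist ((F ^^ i) (P w)) ((F ^^ i) (P e)) \<le> \<epsilon>}
    \<le> (L + 1) ^ (k div L + 1)"
proof -
  let ?S = "{w \<in> markov_paths n \<tau> k. \<forall>i<k. dist ((F ^^ i) (P w)) ((F ^^ i) (P e)) \<le> \<epsilon>}"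
  \<comment> \<open>Admitting \<open>r = L\<close> makes a least \<open>r\<close> exist; this value
    means that the block, possibly cut short at \<open>k\<close>, contains no deviation.\<close>
  define D where "D = (\<lambda>w a r. r = L \<or> (a * L + r < k \<and> w ! (a * L + r) \<noteq> e ! (a * L + r)))"
  define d where "d = (\<lambda>w a. LEAST r. D w a r)"
  define code where "code = (\<lambda>w. map (d w) [0..<k div L + 1])"
  have dD: "D w a (d w a)" for w a
    unfolding d_def by (rule LeastI[of _ L]) (simp add: D_def)
  have dL: "d w a \<le> L" for w a
    unfolding d_def by (rule Least_le) (simp add: D_def)
  have dmin: "\<not> D w a r" if "r < d w a" for w a r
    using that unfolding d_def by (rule not_less_Least)
  have "inj_on code ?S"
  proof (rule inj_onI)
    fix w w' assume w: "w \<in> ?S" and w': "w' \<in> ?S" and eq: "code w = code w'"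
    have "w ! j = w' ! j" if j: "j < k" for j
    proof -
      define a r where "a = j div L" and "r = j mod L"
      have ar: "j = a * L + r" "r < L" using L by (simp_all add: a_def r_def)
      have "a \<le> k div L" using j by (simp add: a_def div_le_mono)
      then have dd: "d w a = d w' a"
        using arg_cong[OF eq, of "\<lambda>l. l ! a"] by (simp add: code_def nth_append del: upt_Suc)
      show ?thesis
      proof (cases "r < d w a")
        case True
        then have "\<not> D w a r" "\<not> D w' a r" using dmin dd by auto
        then show ?thesis using j ar by (simp add: D_def)
      next
        case False
        define t where "t = a * L + d w a"
        have "d w a \<noteq> L" using False ar by auto
        then have t: "t < k" "w ! t \<noteq> e ! t" "w' ! t \<noteq> e ! t"
          using dD[of w a] dD[of w' a] dd by (auto simp: D_def t_def)
        \<comment> \<open>Both paths first leave \<open>e\<close> in this block at the same time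
          \<open>t\<close>, fewer than \<open>L\<close> steps before \<open>j\<close>.\<close>
        have "w ! (t + (r - d w a)) = w' ! (t + (r - d w a))"
        proof (rule shadowing_unique[OF equi \<epsilon> e P[OF e] _ _ _ _ _ _ t])
          show "t + (r - d w a) < k" "r - d w a < L" using False ar j by (auto simp: t_def)
        qed (use w w' P in auto)
        moreover have "t + (r - d w a) = j" using False ar by (simp add: t_def)
        ultimately show ?thesis by simp
      qed
    qed
    then show "w = w'" using w w' by (auto intro!: nth_equalityI simp: markov_paths_def)
  qed
  moreover have "code ` ?S \<subseteq> {l. set l \<subseteq> {0..L} \<and> length l = k div L + 1}"
    using dL by (auto simp: code_def simp del: upt_Suc)
  ultimately have "card ?S \<le> card {l. set l \<subseteq> {0..L} \<and> length l = k div L + 1}"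
    by (intro card_inj_on_le finite_lists_length_eq) auto
  also have "\<dots> = (L + 1) ^ (k div L + 1)"
    by (subst card_lists_length_eq) auto
  finally show ?thesis .
qed

section \<open>Separated sets from realized paths\<close>

lemma funpow_cylinder: "u \<in> cylinder \<Longrightarrow> (F ^^ r) u \<in> cylinder"
  using inv by (induction r) auto

lemma funpow_cont: "continuous_on cylinder (F ^^ r)"
proof (induction r)
  case (Suc r)
  have "continuous_on cylinder (\<lambda>u. F ((F ^^ r) u))"
    using funpow_cylinder by (intro continuous_on_compose2[OF cont Suc]) auto
  then show ?case by (simp add: comp_def)
qed (simp add: continuous_on_id)

lemma iterates_equicontinuous:
  obtains \<epsilon> where "\<epsilon> > 0" "2 * \<epsilon> < \<delta>"
    "\<And>u v r. u \<in> cylinder \<Longrightarrow> v \<in> cylinder \<Longrightarrow> dist u v \<le> \<epsilon> \<Longrightarrow> r < L \<Longrightarrow>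
      dist ((F ^^ r) u) ((F ^^ r) v) < \<delta>"
proof -
  have "compact cylinder"
    unfolding cylinder_def unit_interval_def by (intro compact_Times compact_circle) auto
  then have "\<exists>e>0. \<forall>u\<in>cylinder. \<forall>v\<in>cylinder. dist v u < e \<longrightarrow> dist ((F ^^ r) v) ((F ^^ r) u) < \<delta>" for r
    using compact_uniformly_continuous[OF funpow_cont] \<delta>_pos unfolding uniformly_continuous_on_def by blast
  then obtain e where e: "\<And>r. e r > 0"
    "\<And>r u v. u \<in> cylinder \<Longrightarrow> v \<in> cylinder \<Longrightarrow> dist v u < e r \<Longrightarrow> dist ((F ^^ r) v) ((F ^^ r) u) < \<delta>"
    by metis
  \<comment> \<open>Only finitely many iterates are involved. Including \<open>\<delta>\<close> in
    the minimum yields \<open>2 * (m / 3) < \<delta>\<close>, and a third of \<open>m\<close> is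
    strictly below each modulus \<open>e r\<close>.\<close>
  define m where "m = Min (insert \<delta> (e ` {..<L}))"
  have m: "m > 0" "m \<le> \<delta>" "\<And>r. r < L \<Longrightarrow> m \<le> e r"
    using e(1) \<delta>_pos by (auto simp: m_def)
  show ?thesis
  proof (rule that[of "m / 3"])
    fix u v r assume "u \<in> cylinder" "v \<in> cylinder" "dist u v \<le> m / 3" "r < L"
    moreover from this have "dist u v < e r" using m(1) m(3)[of r] by linarith
    ultimately show "dist ((F ^^ r) u) ((F ^^ r) v) < \<delta>" using e(2) by blast
  qed (use m in auto)
qed

text \<open>The points of a maximal family of pairwise distinguishable realizations are separated.
  Every path is indistinguishable from a member of the family, so \<open>shadowing_card_le\<close>
  bounds the loss. The scale depends on \<open>L\<close> but not on \<open>k\<close>.\<close>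

lemma markov_paths_card_le:
  assumes "L > 0"
  obtains \<epsilon> where "\<epsilon> > 0"
    "\<And>k. k > 0 \<Longrightarrow> \<exists>E. finite E \<and> separated cylinder F k \<epsilon> E \<and>
       card (markov_paths n \<tau> k) \<le> card E * (L + 1) ^ (k div L + 1)"
proof -
  obtain \<epsilon> where \<epsilon>: "\<epsilon> > 0" "2 * \<epsilon> < \<delta>"
    and equi: "\<And>u v r. u \<in> cylinder \<Longrightarrow> v \<in> cylinder \<Longrightarrow> dist u v \<le> \<epsilon> \<Longrightarrow> r < L \<Longrightarrow>
      dist ((F ^^ r) u) ((F ^^ r) v) < \<delta>"
    using iterates_equicontinuous[of L] by blast
  show ?thesis
  proof (rule that[OF \<epsilon>(1)])
    fix k :: nat assume k: "k > 0"
    have "\<exists>u. realizes w u" if "w \<in> markov_paths n \<tau> k" for w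
      using path_realized[OF that k, of 0] that by (auto simp: realizes_def markov_paths_def)
    then obtain P where P: "\<And>w. w \<in> markov_paths n \<tau> k \<Longrightarrow> realizes w (P w)" by metis
    define R where "R = (\<lambda>v w. \<forall>i<k. dist ((F ^^ i) (P w)) ((F ^^ i) (P v)) \<le> \<epsilon>)"
    have "R w w" "R v w \<Longrightarrow> R w v" for v w
      using \<epsilon>(1) by (simp_all add: R_def dist_commute)
    then obtain V where V: "V \<subseteq> markov_paths n \<tau> k" "\<forall>v\<in>V. \<forall>v'\<in>V. v \<noteq> v' \<longrightarrow> \<not> R v v'"
      "\<forall>w\<in>markov_paths n \<tau> k. \<exists>v\<in>V. R v w"
      using maximal_unrelated_subset[OF finite_markov_paths, of R n \<tau> k] by metis
    have finV: "finite V" using V(1) finite_markov_paths by (rule finite_subset)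
    have "card (markov_paths n \<tau> k) \<le> card (\<Union>v\<in>V. {w \<in> markov_paths n \<tau> k. R v w})"
      using V(3) finV finite_markov_paths by (intro card_mono) auto
    also have "\<dots> \<le> (\<Sum>v\<in>V. card {w \<in> markov_paths n \<tau> k. R v w})"
      by (rule card_UN_le[OF finV])
    also have "\<dots> \<le> (\<Sum>v\<in>V. (L + 1) ^ (k div L + 1))"
    proof (rule sum_mono)
      fix v assume "v \<in> V"
      then show "card {w \<in> markov_paths n \<tau> k. R v w} \<le> (L + 1) ^ (k div L + 1)"
        unfolding R_def using V(1) by (intro shadowing_card_le[OF equi \<epsilon>(2) assms P]) auto
    qed
    finally have "card (markov_paths n \<tau> k) \<le> card V * (L + 1) ^ (k div L + 1)" by simp
    moreover have "inj_on P V"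
    proof (rule inj_onI, rule ccontr)
      fix v v' assume "v \<in> V" "v' \<in> V" "P v = P v'" "v \<noteq> v'"
      moreover from this have "R v v'" using \<epsilon>(1) by (simp add: R_def)
      ultimately show False using V(2) by blast
    qed
    then have "card (P ` V) = card V" by (rule card_image)
    moreover have "separated cylinder F k \<epsilon> (P ` V)"
      unfolding separated_def
    proof (intro conjI ballI impI)
      show "P ` V \<subseteq> cylinder"
      proof
        fix u assume "u \<in> P ` V"
        then obtain v where v: "v \<in> markov_paths n \<tau> k" "u = P v" using V(1) by auto
        then have "(F ^^ 0) u \<in> gap 0 (v ! 0)"
          using P[OF v(1)] k unfolding realizes_def markov_paths_def by blast
        then show "u \<in> cylinder" using gap_subset_cylinder[OF markov_paths_nth[OF v(1) k]] by auto
      qed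
    next
      fix x y assume "x \<in> P ` V" "y \<in> P ` V" "x \<noteq> y"
      then obtain v v' where "v \<in> V" "v' \<in> V" "x = P v" "y = P v'" "v \<noteq> v'" by blast
      then show "\<exists>i<k. dist ((F ^^ i) x) ((F ^^ i) y) > \<epsilon>"
        using V(2) by (metis R_def dist_commute not_le)
    qed
    ultimately show "\<exists>E. finite E \<and> separated cylinder F k \<epsilon> E \<and>
       card (markov_paths n \<tau> k) \<le> card E * (L + 1) ^ (k div L + 1)"
      using finV by (intro exI[of _ "P ` V"]) auto
  qed
qed

lemma ln_card_markov_paths_le:
  assumes "L > 0"
  obtains \<epsilon> where "\<epsilon> > 0"
    "\<And>k. k > 0 \<Longrightarrow> ereal (ln (real (card (markov_paths n \<tau> k)))) \<le>
       log_max_separated cylinder F k \<epsilon> + ereal ((real k / real L + 1) * ln (real (L + 1)))"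
proof -
  obtain \<epsilon> where \<epsilon>: "\<epsilon> > 0"
    and E: "\<And>k. k > 0 \<Longrightarrow> \<exists>E. finite E \<and> separated cylinder F k \<epsilon> E \<and>
       card (markov_paths n \<tau> k) \<le> card E * (L + 1) ^ (k div L + 1)"
    using markov_paths_card_le[OF assms] by blast
  show ?thesis
  proof (rule that[OF \<epsilon>])
    fix k :: nat assume "k > 0"
    then obtain E where E: "finite E" "separated cylinder F k \<epsilon> E"
       "card (markov_paths n \<tau> k) \<le> card E * (L + 1) ^ (k div L + 1)" using E by blast
    have m: "real (k div L + 1) * ln (real (L + 1)) \<le> (real k / real L + 1) * ln (real (L + 1))"
      using of_nat_div_le_of_nat[of k L, where ?'a = real] by (intro mult_right_mono) auto
    have "ln (real (card (markov_paths n \<tau> k))) \<le> ln (real (card E)) + (real k / real L + 1) * ln (real (L + 1))"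
    proof (cases "card (markov_paths n \<tau> k) = 0")
      case True
      \<comment> \<open>Here \<open>E\<close> may be empty, where \<open>ln 0 = 0\<close>.\<close>
      have "0 \<le> ln (real (card E))" by (cases "card E = 0") auto
      then show ?thesis using True by (auto intro: add_nonneg_nonneg)
    next
      case False
      then have "card E > 0" using E(3) by (cases "card E") auto
      have "real (card (markov_paths n \<tau> k)) \<le> real (card E) * real (L + 1) ^ (k div L + 1)"
        using E(3) by (metis of_nat_le_iff of_nat_mult of_nat_power)
      then have "ln (real (card (markov_paths n \<tau> k))) \<le> ln (real (card E) * real (L + 1) ^ (k div L + 1))"
        using False \<open>card E > 0\<close> by (subst ln_le_cancel_iff) auto
      also have "\<dots> = ln (real (card E)) + real (k div L + 1) * ln (real (L + 1))"
        using \<open>card E > 0\<close> by (subst ln_mult_pos) (simp_all only: ln_realpow of_nat_0_less_iff zero_less_power add_pos_pos zero_less_one trans_less_add2)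
      finally show ?thesis using m by simp
    qed
    then have "ereal (ln (real (card (markov_paths n \<tau> k)))) \<le>
        ereal (ln (real (card E))) + ereal ((real k / real L + 1) * ln (real (L + 1)))" by simp
    also have "\<dots> \<le> log_max_separated cylinder F k \<epsilon> + ereal ((real k / real L + 1) * ln (real (L + 1)))"
      by (intro add_right_mono card_le_log_max_separated E)
    finally show "ereal (ln (real (card (markov_paths n \<tau> k)))) \<le>
       log_max_separated cylinder F k \<epsilon> + ereal ((real k / real L + 1) * ln (real (L + 1)))" .
  qed
qed

end

section \<open>From the hypotheses to the strips and the marked points\<close>

lemma exists_strip_orbit:
  assumes F: "F \<in> forced_maps" and ex: "exhibits_strips_pattern F n \<tau>"
  obtains \<theta> B \<delta> where "strip_orbit F \<theta> B n \<tau> \<delta>"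
proof -
  obtain \<B> A where A: "periodic_strip F n A" "\<B> = {(F ^^ i) ` A | i. i < n}" and pat: "has_strips_pattern F n \<B> \<tau>"
    using ex unfolding exhibits_strips_pattern_def periodic_strip_orbit_def by blast
  obtain B where perm: "\<tau> permutes {1..n}" and bij: "bij_betw B {1..n} \<B>"
    and less: "\<forall>i\<in>{1..n}. \<forall>j\<in>{1..n}. i < j \<longrightarrow> strip_less (B i) (B j)"
    and FB: "\<forall>i\<in>{1..n}. F ` B i = B (\<tau> i)"
    using pat unfolding has_strips_pattern_def by blast
  obtain \<omega> f where f: "continuous_on cylinder f" "f ` cylinder \<subseteq> unit_interval"
    and Ff: "\<forall>\<theta>\<in>circle. \<forall>x\<in>unit_interval. F (\<theta>, x) = (rot \<omega> \<theta>, f (\<theta>, x))"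
    using F unfolding forced_maps_def by blast
  have B_in: "\<exists>m<n. B i = (F ^^ m) ` A" if "i \<in> {1..n}" for i
    using bij_betwE[OF bij] that A(2) by blast
  have strip_B: "strip (B i)" if "i \<in> {1..n}" for i
    using B_in[OF that] A(1) unfolding periodic_strip_def by auto
  have disj: "B i \<inter> B j = {}" if ij: "i \<in> {1..n}" "j \<in> {1..n}" "i \<noteq> j" for i j
  proof -
    obtain m m' where "m < n" "B i = (F ^^ m) ` A" "m' < n" "B j = (F ^^ m') ` A"
      using B_in[OF ij(1)] B_in[OF ij(2)] by blast
    \<comment> \<open>Distinct strips come from distinct iterates, so the disjointness of the
      iterates applies.\<close>
    moreover have "B i \<noteq> B j" using bij ij unfolding bij_betw_def inj_on_def by blast
    ultimately show ?thesis using A(1) unfolding periodic_strip_def by metis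
  qed
  have "compact cylinder"
    unfolding cylinder_def unit_interval_def by (intro compact_Times compact_circle) auto
  then have B_props: "compact (B i)" "B i \<subseteq> cylinder" "fst ` B i = circle" if "i \<in> {1..n}" for i
    using strip_B[OF that] compact_Int_closed[of cylinder "B i"]
    unfolding strip_def by (auto simp: Int_absorb1 Int_commute)
  have "\<exists>\<delta>>0. \<forall>u\<in>B i. \<forall>v\<in>B (Suc i). \<delta> \<le> dist u v" if "i \<in> {1..<n}" for i
    using that B_props(1)[of i] compact_imp_closed[OF B_props(1)[of "Suc i"]] disj[of i "Suc i"]
    by (intro separate_compact_closed) auto
  then obtain d where d: "\<And>i. i \<in> {1..<n} \<Longrightarrow> d i > 0"
    "\<And>i u v. i \<in> {1..<n} \<Longrightarrow> u \<in> B i \<Longrightarrow> v \<in> B (Suc i) \<Longrightarrow> d i \<le> dist u v"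
    by metis
  \<comment> \<open>Inserting 1 keeps the minimum defined for \<open>n = 1\<close>, where there are
    no neighbouring strips.\<close>
  define \<delta> where "\<delta> = Min (insert 1 (d ` {1..<n}))"
  have \<delta>: "\<delta> > 0" "\<And>i. i \<in> {1..<n} \<Longrightarrow> \<delta> \<le> d i"
    using d(1) by (simp add: \<delta>_def) (simp only: \<delta>_def, rule Min_le, auto)
  have "\<exists>G. residual_in (top_of_set circle) G \<and> (\<forall>\<theta>\<in>G. strip_max (B i) \<theta> < strip_min (B (Suc i)) \<theta>)"
    if "i \<in> {1..<n}" for i
    using less that unfolding strip_less_def by auto
  then obtain G where G: "\<And>i. i \<in> {1..<n} \<Longrightarrow> residual_in (top_of_set circle) (G i)"
    "\<And>i \<theta>. i \<in> {1..<n} \<Longrightarrow> \<theta> \<in> G i \<Longrightarrow> strip_max (B i) \<theta> < strip_min (B (Suc i)) \<theta>"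
    by metis
  \<comment> \<open>There are finitely many neighbouring pairs, so one base orbit can avoid all
    their exceptional sets.\<close>
  obtain \<theta>0 where \<theta>0: "\<theta>0 \<in> circle" "\<And>i k. i \<in> {1..<n} \<Longrightarrow> (rot \<omega> ^^ k) \<theta>0 \<in> G i"
    using residual_orbit_exists[of "{1..<n}" G \<omega>] G(1) by blast
  have "continuous_on cylinder (\<lambda>u. (rot \<omega> (fst u), f u))"
    unfolding rot_def by (intro continuous_intros f(1))
  then have cont: "continuous_on cylinder F"
    by (rule continuous_on_eq) (use Ff in \<open>auto simp: cylinder_def\<close>)
  show ?thesis
  proof (rule that[of "\<lambda>j. (rot \<omega> ^^ j) \<theta>0" B \<delta>], unfold_locales)
    show "F ` cylinder \<subseteq> cylinder"
      using Ff f(2) rot_in_circle by (auto simp: cylinder_def)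
    show "fst (F ((rot \<omega> ^^ j) \<theta>0, x)) = (rot \<omega> ^^ Suc j) \<theta>0" if "x \<in> {0..1}" for j x
      using Ff rot_funpow_in_circle[OF \<theta>0(1)] that by (simp add: unit_interval_def)
    show "\<delta> \<le> dist u v" if "i \<in> {1..<n}" "u \<in> B i" "v \<in> B (Suc i)" for i u v
      using d(2)[OF that] \<delta>(2)[OF that(1)] by simp
  qed (use perm cont B_props FB \<delta>(1) G(2) \<theta>0 rot_funpow_in_circle in auto)
qed

lemma exists_tau_linear_map:
  assumes cyc: "cyclic_permutation n \<tau>" and lin: "tau_linear n \<tau> f"
  obtains q where "tau_linear_map n \<tau> f q"
proof -
  obtain q where "strict_mono_on {1..n} q" "q ` {1..n} \<subseteq> unit_interval" "\<forall>i\<in>{1..n}. f (q i) = q (\<tau> i)"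
    "\<forall>i\<in>{1..<n}. \<exists>a b. \<forall>x\<in>{q i..q (Suc i)}. f x = a * x + b"
    "\<forall>C\<in>components (unit_interval - {q 1..q n}). f constant_on C"
    using lin unfolding tau_linear_def by blast
  moreover have "n > 0" using cyc by (auto simp: cyclic_permutation_def cyclic_on_def intro!: Nat.gr0I)
  ultimately have "tau_linear_map n \<tau> f q"
    using cyc lin by unfold_locales (auto simp: cyclic_permutation_def tau_linear_def unit_interval_def)
  then show ?thesis by (rule that)
qed

section \<open>Comparison of the entropies\<close>

lemma top_entropy_nonneg: "0 \<le> top_entropy X T"
proof -
  have "0 \<le> limsup (\<lambda>n. log_max_separated X T n 1 / ereal (real n))"
  proof (rule le_Limsup)
    show "\<forall>\<^sub>F n in sequentially. 0 \<le> log_max_separated X T n 1 / ereal (real n)"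
      using eventually_gt_at_top[of 0]
    proof eventually_elim
      case (elim n)
      then have "0 / ereal (real n) \<le> log_max_separated X T n 1 / ereal (real n)"
        by (intro ereal_divide_right_mono log_max_separated_nonneg) auto
      then show ?case by simp
    qed
  qed simp
  also have "\<dots> \<le> top_entropy X T" by (rule limsup_le_top_entropy) simp
  finally show ?thesis .
qed

text \<open>For every \<open>L\<close>, bounding separated sets of \<open>f\<close> by words and
  words by separated sets of \<open>F\<close> gives the inequality up to
  \<open>ln (L + 1) / L\<close>. The scale for \<open>F\<close> depends on \<open>L\<close>, but
  \<open>top_entropy\<close> dominates every scale, so \<open>L\<close> can tend to
  infinity.\<close>

lemma tau_linear_entropy_le:
  assumes cyc: "cyclic_permutation n \<tau>" and F: "F \<in> forced_maps" and ex: "exhibits_strips_pattern F n \<tau>"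
    and lin: "tau_linear n \<tau> f"
  shows "top_entropy unit_interval f \<le> top_entropy cylinder F"
  unfolding top_entropy_def[of unit_interval]
proof (rule SUP_least)
  fix \<epsilon>' :: real assume "\<epsilon>' \<in> {0<..}"
  then have \<epsilon>': "\<epsilon>' > 0" by simp
  obtain q where "tau_linear_map n \<tau> f q" using exists_tau_linear_map[OF cyc lin] .
  then interpret lin: tau_linear_map n \<tau> f q .
  obtain \<theta> B \<delta> where "strip_orbit F \<theta> B n \<tau> \<delta>" using exists_strip_orbit[OF F ex] .
  then interpret orb: strip_orbit F \<theta> B n \<tau> \<delta> .
  let ?h = "limsup (\<lambda>k. log_max_separated unit_interval f k \<epsilon>' / ereal (real k))"
  have le: "?h \<le> top_entropy cylinder F + ereal (ln (real (L + 1)) / real L)" if L: "L > 0" for L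
  proof -
    obtain \<epsilon> where \<epsilon>: "\<epsilon> > 0"
      and paths: "\<And>k. k > 0 \<Longrightarrow> ereal (ln (real (card (markov_paths n \<tau> k)))) \<le>
       log_max_separated cylinder F k \<epsilon> + ereal ((real k / real L + 1) * ln (real (L + 1)))"
      using orb.ln_card_markov_paths_le[OF L] by blast
    define r where "r = (\<lambda>k. (real k / real L + 1) * ln (real (L + 1)) + ln (real (n + 1)) + ln (2 * real k / \<epsilon>' + 3))"
    \<comment> \<open>For \<open>n = 1\<close> there is one word, with logarithm 0, and
      nonnegativity of the right side suffices.\<close>
    have words: "ereal (ln (real (card (lin.words k)))) \<le>
       log_max_separated cylinder F k \<epsilon> + ereal ((real k / real L + 1) * ln (real (L + 1)))" if "k > 0" for k
    proof (cases "n = 1")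
      case True
      then have "ln (real (card (lin.words k))) = 0" unfolding lin.words_def by simp
      moreover have "0 \<le> ereal ((real k / real L + 1) * ln (real (L + 1)))" by simp
      ultimately show ?thesis
        using add_nonneg_nonneg[OF log_max_separated_nonneg] by (simp only: zero_ereal_def[symmetric])
    next
      case False
      then show ?thesis using paths[OF that] by (simp add: lin.words_def)
    qed
    have "log_max_separated unit_interval f k \<epsilon>' \<le> log_max_separated cylinder F k \<epsilon> + ereal (r k)"
      if k: "k > 0" for k
    proof -
      let ?c = "ereal (ln (real (n + 1)) + ln (2 * real k / \<epsilon>' + 3))"
      have "log_max_separated unit_interval f k \<epsilon>' \<le> ereal (ln (real (card (lin.words k)))) + ?c"
        using lin.log_max_separated_le[OF k \<epsilon>'] by (simp add: unit_interval_def add.assoc)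
      also have "\<dots> \<le> log_max_separated cylinder F k \<epsilon> + ereal ((real k / real L + 1) * ln (real (L + 1))) + ?c"
        by (intro add_right_mono words k)
      also have "\<dots> = log_max_separated cylinder F k \<epsilon> + ereal (r k)"
        by (simp add: r_def add.assoc)
      finally show ?thesis .
    qed
    moreover have "(\<lambda>k. r k / real k) \<longlonglongrightarrow> ln (real (L + 1)) / real L"
    proof (rule Lim_transform_eventually)
      have "(\<lambda>k. ln (2 * real k / \<epsilon>' + 3) / real k) \<longlonglongrightarrow> 0" using \<epsilon>' by real_asymp
      then have "(\<lambda>k. ln (real (L + 1)) / real L + ln (real (L + 1)) / real k + ln (real (n + 1)) / real k
          + ln (2 * real k / \<epsilon>' + 3) / real k) \<longlonglongrightarrow> ln (real (L + 1)) / real L + 0 + 0 + 0"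
        by (intro tendsto_add tendsto_const lim_const_over_n)
      then show "(\<lambda>k. ln (real (L + 1)) / real L + ln (real (L + 1)) / real k + ln (real (n + 1)) / real k
          + ln (2 * real k / \<epsilon>' + 3) / real k) \<longlonglongrightarrow> ln (real (L + 1)) / real L" by simp
      show "\<forall>\<^sub>F k in sequentially. ln (real (L + 1)) / real L + ln (real (L + 1)) / real k + ln (real (n + 1)) / real k
          + ln (2 * real k / \<epsilon>' + 3) / real k = r k / real k"
        using eventually_gt_at_top[of 0]
        by eventually_elim (simp add: r_def add_divide_distrib distrib_right)
    qed
    ultimately have "?h \<le> limsup (\<lambda>k. log_max_separated cylinder F k \<epsilon> / ereal (real k)) + ereal (ln (real (L + 1)) / real L)"
      by (rule limsup_growth_le)
    also have "\<dots> \<le> top_entropy cylinder F + ereal (ln (real (L + 1)) / real L)"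
      by (intro add_right_mono limsup_le_top_entropy \<epsilon>)
    finally show ?thesis .
  qed
  \<comment> \<open>The loss tends to 0; the limit is taken in \<open>ereal\<close> because the
    entropy of \<open>F\<close> may be infinite.\<close>
  have "(\<lambda>L. ln (real (L + 1)) / real L) \<longlonglongrightarrow> 0" by real_asymp
  then have "(\<lambda>L. ereal (ln (real (L + 1)) / real L)) \<longlonglongrightarrow> ereal 0" by simp
  then have "(\<lambda>L. top_entropy cylinder F + ereal (ln (real (L + 1)) / real L)) \<longlonglongrightarrow> top_entropy cylinder F + ereal 0"
    using top_entropy_nonneg[of cylinder F] by (intro tendsto_add_ereal_general tendsto_const) auto
  then show "?h \<le> top_entropy cylinder F"
    using le by (intro LIMSEQ_le_const[of _ "top_entropy cylinder F"]) (auto intro!: exI[of _ 1])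
qed

theorem theorem3:
  fixes n :: nat and \<tau> :: "nat \<Rightarrow> nat"
    and F :: "complex \<times> real \<Rightarrow> complex \<times> real"
    and f\<^sub>\<tau> :: "real \<Rightarrow> real" and \<omega> :: real
  assumes "cyclic_permutation n \<tau>"
    and "F \<in> forced_maps"
    and "exhibits_strips_pattern F n \<tau>"
    and "tau_linear n \<tau> f\<^sub>\<tau>"
    and "\<omega> \<notin> \<rat>"
  shows "top_entropy cylinder F \<ge> top_entropy cylinder (quasiperiodic_linear \<omega> f\<^sub>\<tau>) \<and>
         top_entropy cylinder (quasiperiodic_linear \<omega> f\<^sub>\<tau>) = top_entropy unit_interval f\<^sub>\<tau>"
  using tau_linear_entropy_le[OF assms(1-4)] by (simp add: top_entropy_quasiperiodic_linear)

end
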